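(* Consider an aggregation protocol for $n$ users (as defined in the context) that satisfies the correctness constraint (C1) and the security constraints (S1) and (S2) with dropout tolerance $D$, for some $D\le n/2$. Let $\mathcal{D}\subset[n]$ be the set of dropout users, with $|\mathcal{D}|\le D$. Then for all $i\in[n]\setminus\mathcal{D}$, $$H(Y_i)\;\ge\; H\Big(\sum_{i'\in[n]\setminus\mathcal{D}}X_{i'}\Big).$$
   Context: $[n]=\{1,\dots,n\}$; $H(\cdot)$ is Shannon entropy (base 2); $I(\cdot;\cdot)$ and $I(\cdot;\cdot\mid\cdot)$ are (conditional) mutual information; $X_A=(X_i)_{i\in A}$ and $\mu(X_A)=\sum_{i\in A}X_i$ for $A\subseteq[n]$; $X^n=X_{[n]}$. Aggregation protocol. There are a single server and $n$ users; user $i\in[n]$ holds a random vector $X_i\in\mathcal{X}$ (no assumption is made on the domain $\mathcal X$), and the server wants the sum of the users' vectors. User $i$ encodes $X_i$ as $Y_i=g_i(X_i;\theta_i)$, where $g_i$ is an encoding function and $\theta_i$ is randomness available at user $i$, independent of $X_i$ but possibly dependent on the other $\theta_{i'}$, $i'\in[n]\setminus\{i\}$. Up to $D$ users may drop out. If the set of dropouts is $\mathcal{D}$, the server observes $Y_{[n]\setminus\mathcal{D}}$. If $\mathcal{D}=\emptyset$, it estimates the sum by a deterministic function $f(Y^n)$. If $\mathcal{D}\ne\emptyset$, the server in a second round of communication collects $h(\theta_{[n]},\mathcal{D})$, where $h$ is a general function of the local secrets $\theta_{[n]}$, and estimates $\mu(X_{[n]\setminus\mathcal{D}})$ by $f(Y_{[n]\setminus\mathcal{D}},h(\theta_{[n]},\mathcal{D}))$.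 Security constraints with dropout tolerance $D$ (a number, not to be confused with the set $\mathcal D$), required for every distribution $P_{X^n}$ of the user data: (S1) for all $\mathcal{D}\subseteq[n]$: $I\big(Y_{[n]\setminus\mathcal{D}},h(\theta_{[n]},\mathcal{D});X_{[n]\setminus\mathcal{D}}\,\big|\,\mu(X_{[n]\setminus\mathcal{D}})\big)=0$; (S2) for all $\mathcal{D}$ with $|\mathcal{D}|>D$: $I\big(Y_{[n]\setminus\mathcal{D}},h(\theta_{[n]},\mathcal{D});X_{[n]\setminus\mathcal{D}}\big)=0$. Correctness constraint: (C1) for all $\mathcal{D}$ with $|\mathcal{D}|\le D$: $\Pr\{f(Y_{[n]\setminus\mathcal{D}},h(\theta_{[n]},\mathcal{D}))=\mu(X_{[n]\setminus\mathcal{D}})\}=1$. *)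

theory Defs
  imports "HOL-Probability.Probability"
begin

section \<open>Information measures of arbitrary random variables\<close>

text \<open>
  The real-valued notions of \<^theory>\<open>HOL-Probability.Information\<close> are Lebesgue integrals, hence \<open>0\<close>
  when the mathematical value is infinite, and they use a junk Radon-Nikodym derivative when
  absolute continuity fails. They agree with the textbook values for finitely valued variables, and
  arbitrary variables are reduced to these by the usual supremum over finite measurable partitions
  (of the range), with values in \<^typ>\<open>ereal\<close>. A partition is given by its cell map.
  For a variable with countably many (measurable) values the entropy below is
  \<open>- (\<Sum>z. P z * log 2 (P z))\<close>, possibly infinite.
\<close>

definition quantizers :: "'a measure \<Rightarrow> ('a \<Rightarrow> nat) set" where
  "quantizers N = {q. simple_function N q}"

definition shannon_entropy :: "'w measure \<Rightarrow> 'a measure \<Rightarrow> ('w \<Rightarrow> 'a) \<Rightarrow> ereal" where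
  "shannon_entropy M N Z =
     (SUP q\<in>quantizers N.
        ereal (prob_space.entropy M 2 (count_space ((q \<circ> Z) ` space M)) (q \<circ> Z)))"

definition mutual_info ::
    "'w measure \<Rightarrow> 'a measure \<Rightarrow> 'b measure \<Rightarrow> ('w \<Rightarrow> 'a) \<Rightarrow> ('w \<Rightarrow> 'b) \<Rightarrow> ereal" where
  "mutual_info M NA NB A B =
     (SUP (q, r)\<in>quantizers NA \<times> quantizers NB.
        ereal (prob_space.mutual_information M 2
          (count_space ((q \<circ> A) ` space M)) (count_space ((r \<circ> B) ` space M)) (q \<circ> A) (r \<circ> B)))"

text \<open>
  Only the first two arguments are quantized; the conditioning variable must be kept as it is. Since
  \<open>q \<circ> A\<close> is finitely valued, both terms \<open>I(q \<circ> A; (r \<circ> B, C))\<close> and \<open>I(q \<circ> A; C)\<close> of the library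
  notion are finite, with bounded densities, for every \<open>C\<close>.
\<close>

definition cond_mutual_info ::
    "'w measure \<Rightarrow> 'a measure \<Rightarrow> 'b measure \<Rightarrow> 'c measure \<Rightarrow>
     ('w \<Rightarrow> 'a) \<Rightarrow> ('w \<Rightarrow> 'b) \<Rightarrow> ('w \<Rightarrow> 'c) \<Rightarrow> ereal" where
  "cond_mutual_info M NA NB NC A B C =
     (SUP (q, r)\<in>quantizers NA \<times> quantizers NB.
        ereal (prob_space.conditional_mutual_information M 2
          (count_space ((q \<circ> A) ` space M)) (count_space ((r \<circ> B) ` space M)) NC (q \<circ> A) (r \<circ> B) C))"

section \<open>Aggregation protocols\<close>

text \<open>
  The users are \<open>{1..users \<Q>}\<close>. The domain of the data is the set \<open>space (data_space \<Q>)\<close>, which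
  need not be closed under addition; sums are measured in \<open>sum_space \<Q>\<close>. The decoder knows which
  users dropped out, so it takes the dropout set as an argument.
\<close>

record ('x, 't, 'y, 'h) protocol =
  users :: nat
  data_space :: "'x measure"
  sum_space :: "'x measure"
  secret_space :: "nat \<Rightarrow> 't measure"
  secret_law :: "(nat \<Rightarrow> 't) measure"
  msg_space :: "nat \<Rightarrow> 'y measure"
  enc :: "nat \<Rightarrow> 'x \<Rightarrow> 't \<Rightarrow> 'y"
  round2_space :: "nat set \<Rightarrow> 'h measure"
  round2 :: "(nat \<Rightarrow> 't) \<Rightarrow> nat set \<Rightarrow> 'h"
  dec :: "nat set \<Rightarrow> (nat \<Rightarrow> 'y) \<times> 'h \<Rightarrow> 'x"

definition all_users :: "('x, 't, 'y, 'h) protocol \<Rightarrow> nat set" where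
  "all_users \<Q> = {1..users \<Q>}"

definition view_space ::
    "('x, 't, 'y, 'h) protocol \<Rightarrow> nat set \<Rightarrow> ((nat \<Rightarrow> 'y) \<times> 'h) measure" where
  "view_space \<Q> \<D> = PiM (all_users \<Q> - \<D>) (msg_space \<Q>) \<Otimes>\<^sub>M round2_space \<Q> \<D>"

text \<open>
  The secrets may be arbitrarily correlated across users. The condition on \<^term>\<open>round2 \<Q> \<theta> {}\<close>
  says that there is no second round if nobody drops out: what is collected is then a constant.
  The condition on sums says that every partial sum of the users' vectors is a random variable.
\<close>

definition aggregation_protocol :: "('x::ab_group_add, 't, 'y, 'h) protocol \<Rightarrow> bool" where
  "aggregation_protocol \<Q> \<longleftrightarrow>
     prob_space (secret_law \<Q>) \<and>
     sets (secret_law \<Q>) = sets (PiM (all_users \<Q>) (secret_space \<Q>)) \<and>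
     (\<forall>i\<in>all_users \<Q>.
        (\<lambda>(x, t). enc \<Q> i x t) \<in> data_space \<Q> \<Otimes>\<^sub>M secret_space \<Q> i \<rightarrow>\<^sub>M msg_space \<Q> i) \<and>
     (\<forall>\<D>\<subseteq>all_users \<Q>. (\<lambda>\<theta>. round2 \<Q> \<theta> \<D>) \<in> secret_law \<Q> \<rightarrow>\<^sub>M round2_space \<Q> \<D>) \<and>
     (\<forall>\<theta>\<in>space (secret_law \<Q>). \<forall>\<theta>'\<in>space (secret_law \<Q>). round2 \<Q> \<theta> {} = round2 \<Q> \<theta>' {}) \<and>
     (\<forall>\<D>\<subseteq>all_users \<Q>. dec \<Q> \<D> \<in> view_space \<Q> \<D> \<rightarrow>\<^sub>M sum_space \<Q>) \<and>
     (\<forall>A\<subseteq>all_users \<Q>.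
        (\<lambda>x. \<Sum>i\<in>A. x i) \<in> PiM (all_users \<Q>) (\<lambda>_. data_space \<Q>) \<rightarrow>\<^sub>M sum_space \<Q>)"

text \<open>The possible joint laws of the users' data, with arbitrary dependence between users.\<close>

definition data_laws :: "('x, 't, 'y, 'h) protocol \<Rightarrow> (nat \<Rightarrow> 'x) measure set" where
  "data_laws \<Q> =
     {P. prob_space P \<and> sets P = sets (PiM (all_users \<Q>) (\<lambda>_. data_space \<Q>))}"

text \<open>
  Sample space: outcomes are pairs \<open>(x, \<theta>)\<close> of the data and the secrets of all users; the product
  measure expresses that the secrets are independent of the data.
\<close>

definition joint ::
    "('x, 't, 'y, 'h) protocol \<Rightarrow> (nat \<Rightarrow> 'x) measure \<Rightarrow> ((nat \<Rightarrow> 'x) \<times> (nat \<Rightarrow> 't)) measure" where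
  "joint \<Q> P = P \<Otimes>\<^sub>M secret_law \<Q>"

definition data :: "nat set \<Rightarrow> (nat \<Rightarrow> 'x) \<times> (nat \<Rightarrow> 't) \<Rightarrow> nat \<Rightarrow> 'x" where
  "data A = (\<lambda>(x, \<theta>). restrict x A)"

definition data_sum :: "nat set \<Rightarrow> (nat \<Rightarrow> 'x::ab_group_add) \<times> (nat \<Rightarrow> 't) \<Rightarrow> 'x" where
  "data_sum A = (\<lambda>(x, \<theta>). \<Sum>i\<in>A. x i)"

definition msg ::
    "('x, 't, 'y, 'h) protocol \<Rightarrow> nat \<Rightarrow> (nat \<Rightarrow> 'x) \<times> (nat \<Rightarrow> 't) \<Rightarrow> 'y" where
  "msg \<Q> i = (\<lambda>(x, \<theta>). enc \<Q> i (x i) (\<theta> i))"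

definition server_view ::
    "('x, 't, 'y, 'h) protocol \<Rightarrow> nat set \<Rightarrow>
     (nat \<Rightarrow> 'x) \<times> (nat \<Rightarrow> 't) \<Rightarrow> (nat \<Rightarrow> 'y) \<times> 'h" where
  "server_view \<Q> \<D> = (\<lambda>\<omega>. (\<lambda>i\<in>all_users \<Q> - \<D>. msg \<Q> i \<omega>, round2 \<Q> (snd \<omega>) \<D>))"

text \<open>The server learns at most the sum of the vectors of the remaining users.\<close>

definition secure_given_sum :: "('x::ab_group_add, 't, 'y, 'h) protocol \<Rightarrow> bool" where
  "secure_given_sum \<Q> \<longleftrightarrow>
     (\<forall>P\<in>data_laws \<Q>. \<forall>\<D>\<subseteq>all_users \<Q>.
        cond_mutual_info (joint \<Q> P)
          (view_space \<Q> \<D>) (PiM (all_users \<Q> - \<D>) (\<lambda>_. data_space \<Q>)) (sum_space \<Q>)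
          (server_view \<Q> \<D>) (data (all_users \<Q> - \<D>)) (data_sum (all_users \<Q> - \<D>)) = 0)"

text \<open>With more than \<open>D\<close> dropouts, the server learns nothing.\<close>

definition secure_beyond :: "('x, 't, 'y, 'h) protocol \<Rightarrow> nat \<Rightarrow> bool" where
  "secure_beyond \<Q> D \<longleftrightarrow>
     (\<forall>P\<in>data_laws \<Q>. \<forall>\<D>\<subseteq>all_users \<Q>. card \<D> > D \<longrightarrow>
        mutual_info (joint \<Q> P)
          (view_space \<Q> \<D>) (PiM (all_users \<Q> - \<D>) (\<lambda>_. data_space \<Q>))
          (server_view \<Q> \<D>) (data (all_users \<Q> - \<D>)) = 0)"

text \<open>
  Almost sure recovery of the sum, for data with law \<open>P\<close>. It is phrased with \<open>AE\<close> because
  the diagonal of \<open>sum_space \<Q>\<close> need not be measurable.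
\<close>

definition correct ::
    "('x::ab_group_add, 't, 'y, 'h) protocol \<Rightarrow> nat \<Rightarrow> (nat \<Rightarrow> 'x) measure \<Rightarrow> bool" where
  "correct \<Q> D P \<longleftrightarrow>
     (\<forall>\<D>\<subseteq>all_users \<Q>. card \<D> \<le> D \<longrightarrow>
        (AE \<omega> in joint \<Q> P.
           dec \<Q> \<D> (server_view \<Q> \<D> \<omega>) = data_sum (all_users \<Q> - \<D>) \<omega>))"

end

theory Submission
  imports Defs
begin

text \<open>
  Write \<open>U\<close> for the surviving users. Applying the first security constraint to data that take two
  values with the same sum shows that the law of the server's view, given the data \<open>x\<close>, depends on
  \<open>x\<close> only through \<open>\<Sum>i\<in>U. x i\<close>. The law of the view without the message of user \<open>i\<close> does not involve
  \<open>x i\<close>; as swapping \<open>x i\<close> and \<open>x j\<close> preserves the sum, it does not depend on \<open>x j\<close> either, so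
  this partial view \<open>V\<close> is independent of the data. By correctness the sum is a function of the message
  \<open>Y\<close> of user \<open>i\<close> and of \<open>V\<close>, and a variable that is independent of \<open>V\<close> and determined by \<open>Y\<close> and
  \<open>V\<close> has entropy at most \<open>H(Y)\<close>. For arbitrary \<open>Y\<close> and \<open>V\<close> the last step needs the decoder to be
  approximated by a function of quantized versions of \<open>Y\<close> and \<open>V\<close>.
\<close>

section \<open>Mutual information with a finitely valued variable\<close>

text \<open>Both signs come from \<open>ln y \<le> y - 1\<close>, taken at \<open>y = x\<close> and
  at \<open>y = 1 / x\<close>. The bound makes \<open>D * log b D\<close> integrable for a bounded
  density \<open>D\<close>.\<close>

lemma abs_mult_ln_le: fixes x :: real assumes "0 \<le> x" shows "\<bar>x * ln x\<bar> \<le> 1 + x\<^sup>2"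
proof (cases "x = 0")
  case False
  with assms have x: "0 < x" by simp
  have "x * ln x \<le> x * (x - 1)"
    using x by (intro mult_left_mono ln_le_minus_one) auto
  moreover have "x * ln (1 / x) \<le> x * (1 / x - 1)"
    using x by (intro mult_left_mono ln_le_minus_one) auto
  moreover have "x * (x - 1) \<le> 1 + x\<^sup>2" "x * (1 / x - 1) \<le> 1 + x\<^sup>2"
    using x by (auto simp: algebra_simps power2_eq_square)
  moreover have "x * ln (1 / x) = - (x * ln x)"
    using x by (simp add: ln_div)
  ultimately show ?thesis
    by linarith
qed simp

text \<open>On the set where \<open>f\<close> exceeds \<open>c\<close> the integral of
  \<open>f - c\<close> vanishes, so this set is null. The integrals may be subtracted because
  \<open>c\<close> and the measure are finite.\<close>

lemma AE_density_bounded: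
  fixes f :: "'a \<Rightarrow> ennreal"
  assumes "finite_measure M" and f[measurable]: "f \<in> borel_measurable M" and c: "c < top"
    and le: "\<And>A. A \<in> sets M \<Longrightarrow> emeasure (density M f) A \<le> c * emeasure M A"
  shows "AE x in M. f x \<le> c"
proof -
  interpret finite_measure M by fact
  let ?E = "{x \<in> space M. c < f x}"
  have E[measurable]: "?E \<in> sets M" by measurable
  have "(\<integral>\<^sup>+x. f x * indicator ?E x - c * indicator ?E x \<partial>M)
      = (\<integral>\<^sup>+x. f x * indicator ?E x \<partial>M) - (\<integral>\<^sup>+x. c * indicator ?E x \<partial>M)"
  proof (intro nn_integral_diff)
    show "(\<integral>\<^sup>+x. c * indicator ?E x \<partial>M) \<noteq> \<infinity>"
      using c emeasure_finite[of ?E] by (simp add: nn_integral_cmult_indicator ennreal_mult_eq_top_iff)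
  qed (auto simp: indicator_def)
  also have "\<dots> = 0"
  proof -
    have "c * emeasure M ?E \<noteq> top"
      using c emeasure_finite[of ?E] by (simp add: ennreal_mult_eq_top_iff)
    moreover have "(\<integral>\<^sup>+x. f x * indicator ?E x \<partial>M) \<le> c * emeasure M ?E"
      using le[OF E] by (simp add: emeasure_density)
    ultimately show ?thesis
      by (simp add: nn_integral_cmult_indicator diff_eq_0_iff_ennreal less_top)
  qed
  finally have "AE x in M. f x * indicator ?E x - c * indicator ?E x = 0"
    by (subst (asm) nn_integral_0_iff_AE) auto
  then show ?thesis
    using AE_space
  proof eventually_elim
    case (elim x)
    then show ?case
      by (cases "c < f x") (auto simp: diff_eq_0_iff_ennreal)
  qed
qed

text \<open>
  The joint law of \<open>X\<close> and \<open>W\<close> is at most \<open>\<Sum>a. 1 / P(X = a)\<close> times the product of the marginals,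
  so its density is bounded.
\<close>
lemma (in information_space) mutual_information_finite_range:
  fixes X :: "'a \<Rightarrow> 'c" and S :: "'c set" and W :: "'a \<Rightarrow> 'd" and T :: "'d measure"
  defines "PP \<equiv> distr M (count_space S) X \<Otimes>\<^sub>M distr M T W"
    and "QQ \<equiv> distr M (count_space S \<Otimes>\<^sub>M T) (\<lambda>x. (X x, W x))"
  assumes S: "finite S" and X[measurable]: "X \<in> M \<rightarrow>\<^sub>M count_space S" and W[measurable]: "W \<in> M \<rightarrow>\<^sub>M T"
  shows mutual_information_finite_range_ac: "absolutely_continuous PP QQ"
    and mutual_information_finite_range_integrable:
      "integrable QQ (entropy_density b PP QQ)"
    and mutual_information_finite_range_nonneg: "0 \<le> mutual_information b (count_space S) T X W"
proof -
  interpret X: prob_space "distr M (count_space S) X"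
    by (rule prob_space_distr) fact
  interpret W: prob_space "distr M T W"
    by (rule prob_space_distr) fact
  interpret XW: pair_prob_space "distr M (count_space S) X" "distr M T W" by standard
  interpret P: information_space "PP" b unfolding PP_def by standard (rule b_gt_1)
  interpret Q: prob_space "QQ" unfolding QQ_def
    by (rule prob_space_distr) simp
  have sets_eq: "sets QQ = sets PP"
    by (simp add: PP_def QQ_def sets_pair_measure)
  define p where "p a = prob {\<omega> \<in> space M. X \<omega> = a}" for a
  define c where "c = (\<Sum>a\<in>S. 1 / p a)"
  have c0: "0 \<le> c" unfolding c_def p_def by (intro sum_nonneg) auto
  have le: "emeasure QQ A \<le> ennreal c * emeasure PP A" if "A \<in> sets PP" for A
  proof -
    have A[measurable]: "A \<in> sets (count_space S \<Otimes>\<^sub>M T)"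
      using that sets_eq by (simp add: QQ_def)
    have A': "A \<in> sets (distr M (count_space S) X \<Otimes>\<^sub>M distr M T W)"
      using that by (simp add: PP_def)
    have part: "measure QQ (A \<inter> {a} \<times> space T) \<le> 1 / p a * measure PP A" if a: "a \<in> S" for a
    proof -
      define B where "B = Pair a -` A"
      have B[measurable]: "B \<in> sets T" unfolding B_def by (rule sets_Pair1[OF A])
      have BT: "B \<subseteq> space T" using sets.sets_into_space[OF B] .
      have a1[measurable]: "{a} \<in> sets (count_space S)" using a by simp
      have "{a} \<times> B \<subseteq> A" by (auto simp: B_def)
      then have "measure PP ({a} \<times> B) \<le> measure PP A"
        using A' by (intro P.finite_measure_mono) (auto simp: PP_def)
      moreover have "measure PP ({a} \<times> B) = p a * prob {\<omega> \<in> space M. W \<omega> \<in> B}"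
        unfolding PP_def using B a1
        by (simp add: measure_def W.emeasure_pair_measure_Times enn2real_mult emeasure_distr p_def vimage_def Int_def conj_commute)
      moreover have *: "measure QQ (A \<inter> {a} \<times> space T) = prob {\<omega> \<in> space M. X \<omega> = a \<and> W \<omega> \<in> B}"
        unfolding QQ_def using a1
        by (subst measure_distr) (auto simp: B_def dest: measurable_space[OF W] intro!: arg_cong[where f=prob])
      moreover have "\<dots> \<le> prob {\<omega> \<in> space M. W \<omega> \<in> B}"
        by (intro finite_measure_mono) auto
      moreover have "prob {\<omega> \<in> space M. X \<omega> = a \<and> W \<omega> \<in> B} \<le> p a"
        unfolding p_def by (intro finite_measure_mono) (use a in measurable, auto)
      moreover have "0 \<le> p a" by (simp add: p_def)
      moreover from calculation have "p a * prob {\<omega> \<in> space M. X \<omega> = a \<and> W \<omega> \<in> B}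
          \<le> p a * prob {\<omega> \<in> space M. W \<omega> \<in> B}"
        by (intro mult_left_mono) auto
      \<comment> \<open>The case \<open>p a = 0\<close> is recorded separately:
        \<open>1 / p a\<close> is then 0 by convention, so the slice has to be null, which holds
        since its mass is at most \<open>p a\<close>.\<close>
      ultimately have "p a * measure QQ (A \<inter> {a} \<times> space T) \<le> measure PP A
          \<and> (p a = 0 \<longrightarrow> measure QQ (A \<inter> {a} \<times> space T) \<le> 0)"
        unfolding * by linarith
      then show ?thesis
        using \<open>0 \<le> p a\<close> by (cases "p a = 0") (auto simp: field_simps)
    qed
    have AS: "A = (\<Union>a\<in>S. A \<inter> {a} \<times> space T)"
      using sets.sets_into_space[OF A] by (auto simp: space_pair_measure)
    have "measure QQ A \<le> (\<Sum>a\<in>S. measure QQ (A \<inter> {a} \<times> space T))"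
      by (subst AS, rule Q.finite_measure_subadditive_finite[OF S]) (auto simp: QQ_def intro!: sets.Int)
    also have "\<dots> \<le> c * measure PP A"
      unfolding c_def sum_distrib_right by (intro sum_mono part)
    finally show ?thesis
      by (simp add: Q.emeasure_eq_measure P.emeasure_eq_measure ennreal_mult[symmetric] c0)
  qed
  show ac: "absolutely_continuous PP QQ"
    unfolding absolutely_continuous_def
  proof
    fix A assume "A \<in> null_sets PP"
    with le[of A] show "A \<in> null_sets QQ"
      by (auto simp: null_sets_def sets_eq)
  qed
  have "finite_measure QQ" by unfold_locales
  from P.real_RN_deriv[OF this ac sets_eq] obtain D
    where D[measurable]: "D \<in> borel_measurable PP"
      and RN: "AE x in PP. RN_deriv PP QQ x = ennreal (D x)"
      and D0: "\<And>x. 0 \<le> D x"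
    by this auto
  have "QQ = density PP (RN_deriv PP QQ)"
    using ac sets_eq by (rule P.density_RN_deriv[symmetric])
  also have "\<dots> = density PP D"
    using RN by (intro density_cong) auto
  finally have Q: "QQ = density PP D" .
  have "AE x in PP. ennreal (D x) \<le> ennreal c"
    using le by (intro AE_density_bounded) (auto simp: Q[symmetric] P.finite_measure_axioms)
  then have Dc: "AE x in PP. D x \<le> c"
    using c0 by (auto simp: ennreal_le_iff)
  \<comment> \<open>The divergence is a Lebesgue integral with default value 0, so it is meaningful
    only once integrability is known; boundedness of \<open>D\<close> supplies it.\<close>
  have "integrable PP (\<lambda>x. D x * log b (D x))"
  proof (rule P.integrable_const_bound[of _ "(1 + c\<^sup>2) / ln b"])
    show "AE x in PP. norm (D x * log b (D x)) \<le> (1 + c\<^sup>2) / ln b"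
      using Dc
    proof eventually_elim
      case (elim x)
      have "\<bar>D x * ln (D x)\<bar> \<le> 1 + (D x)\<^sup>2" by (rule abs_mult_ln_le[OF D0])
      also have "\<dots> \<le> 1 + c\<^sup>2" using elim D0[of x] by (simp add: power_mono)
      finally show ?case
        using b_gt_1 by (simp add: log_def divide_right_mono)
    qed
  qed measurable
  note int = this
  show "integrable QQ (entropy_density b PP QQ)"
  proof -
    have "integrable QQ (\<lambda>x. log b (D x))"
      unfolding Q using int D0 by (subst integrable_real_density) (auto simp: mult.commute)
    moreover have "AE x in QQ. log b (D x) = entropy_density b PP QQ x"
      using absolutely_continuous_AE[OF sets_eq ac RN] 
      by eventually_elim (simp add: entropy_density_def D0)
    moreover have "entropy_density b PP QQ \<in> borel_measurable QQ"
      using measurable_entropy_density by (simp add: measurable_cong_sets[OF sets_eq refl])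
    moreover have "(\<lambda>x. log b (D x)) \<in> borel_measurable QQ"
      unfolding measurable_cong_sets[OF sets_eq refl] by measurable
    ultimately show ?thesis
      by (subst integrable_cong_AE[where g="\<lambda>x. log b (D x)"]) auto
  qed
  have "0 \<le> KL_divergence b PP (density PP D)"
    using int D0 Q.prob_space_axioms by (intro P.KL_nonneg) (auto simp: Q[symmetric])
  then show "0 \<le> mutual_information b (count_space S) T X W"
    unfolding mutual_information_def Q[symmetric] by (simp add: PP_def QQ_def)
qed

text \<open>Factorization on rectangles makes the joint law the product of the marginals, and a
  measure has divergence 0 from itself. This disposes of the term \<open>I(q \<circ> A; C)\<close>
  in the conditional mutual information.\<close>

lemma (in information_space) mutual_information_eq_0_if_indep:
  assumes X[measurable]: "X \<in> M \<rightarrow>\<^sub>M S" and Y[measurable]: "Y \<in> M \<rightarrow>\<^sub>M T"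
    and eq: "\<And>A B. A \<in> sets S \<Longrightarrow> B \<in> sets T \<Longrightarrow> prob {\<omega> \<in> space M. X \<omega> \<in> A \<and> Y \<omega> \<in> B}
      = prob {\<omega> \<in> space M. X \<omega> \<in> A} * prob {\<omega> \<in> space M. Y \<omega> \<in> B}"
  shows "mutual_information b S T X Y = 0"
proof -
  interpret X: prob_space "distr M S X"
    by (rule prob_space_distr) fact
  interpret Y: prob_space "distr M T Y"
    by (rule prob_space_distr) fact
  interpret XY: pair_prob_space "distr M S X" "distr M T Y" by standard
  have "distr M S X \<Otimes>\<^sub>M distr M T Y = distr M (S \<Otimes>\<^sub>M T) (\<lambda>\<omega>. (X \<omega>, Y \<omega>))"
  proof (rule pair_measure_eqI)
    fix A B assume A: "A \<in> sets (distr M S X)" and B: "B \<in> sets (distr M T Y)"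
    have "X -` A \<inter> space M = {\<omega> \<in> space M. X \<omega> \<in> A}" "Y -` B \<inter> space M = {\<omega> \<in> space M. Y \<omega> \<in> B}"
      "(\<lambda>\<omega>. (X \<omega>, Y \<omega>)) -` (A \<times> B) \<inter> space M = {\<omega> \<in> space M. X \<omega> \<in> A \<and> Y \<omega> \<in> B}"
      by auto
    then show "emeasure (distr M S X) A * emeasure (distr M T Y) B
        = emeasure (distr M (S \<Otimes>\<^sub>M T) (\<lambda>\<omega>. (X \<omega>, Y \<omega>))) (A \<times> B)"
      using A B by (simp add: emeasure_distr emeasure_eq_measure eq ennreal_mult)
  qed (simp_all add: sets_pair_measure X.sigma_finite_measure_axioms Y.sigma_finite_measure_axioms)
  then show ?thesis
    unfolding mutual_information_def using XY.KL_same_eq_0 by simp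
qed

text \<open>Nonnegativity turns the bound into divergence 0, and with absolute continuity and
  integrability this forces the joint law to be the product law. The hypothesis is an inequality
  because a supremum bounds its terms only from above.\<close>

lemma (in information_space) indep_if_mutual_information_le_0:
  assumes S: "finite S" and X[measurable]: "X \<in> M \<rightarrow>\<^sub>M count_space S" and W[measurable]: "W \<in> M \<rightarrow>\<^sub>M T"
    and le: "mutual_information b (count_space S) T X W \<le> 0"
    and A: "A \<in> sets (count_space S)" and B: "B \<in> sets T"
  shows "prob {\<omega> \<in> space M. X \<omega> \<in> A \<and> W \<omega> \<in> B}
    = prob {\<omega> \<in> space M. X \<omega> \<in> A} * prob {\<omega> \<in> space M. W \<omega> \<in> B}"
proof -
  let ?P = "distr M (count_space S) X \<Otimes>\<^sub>M distr M T W"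
    and ?Q = "distr M (count_space S \<Otimes>\<^sub>M T) (\<lambda>x. (X x, W x))"
  interpret X: prob_space "distr M (count_space S) X"
    by (rule prob_space_distr) fact
  interpret W: prob_space "distr M T W"
    by (rule prob_space_distr) fact
  interpret XW: pair_prob_space "distr M (count_space S) X" "distr M T W" by standard
  interpret P: information_space ?P b by standard (rule b_gt_1)
  have "?Q = ?P"
  proof (rule P.KL_eq_0_iff_eq_ac[THEN iffD1])
    show "prob_space ?Q" by (rule prob_space_distr) simp
    show "KL_divergence b ?P ?Q = 0"
      using le mutual_information_finite_range_nonneg[OF S X W] by (simp add: mutual_information_def)
    show "sets ?Q = sets ?P" by (simp add: sets_pair_measure)
  qed (use mutual_information_finite_range_ac[OF S X W] mutual_information_finite_range_integrable[OF S X W]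
      in auto)
  then have "emeasure ?Q (A \<times> B) = emeasure (distr M (count_space S) X) A * emeasure (distr M T W) B"
    using A B by (simp add: W.emeasure_pair_measure_Times)
  moreover have "X -` A \<inter> space M = {\<omega> \<in> space M. X \<omega> \<in> A}" "W -` B \<inter> space M = {\<omega> \<in> space M. W \<omega> \<in> B}"
    "(\<lambda>\<omega>. (X \<omega>, W \<omega>)) -` (A \<times> B) \<inter> space M = {\<omega> \<in> space M. X \<omega> \<in> A \<and> W \<omega> \<in> B}"
    by auto
  ultimately show ?thesis
    using A B by (simp add: emeasure_distr emeasure_eq_measure ennreal_mult[symmetric])
qed

section \<open>Entropy and side information\<close>

text \<open>Follows from \<open>ln y \<le> y - 1\<close> at \<open>y = 1 / sqrt x\<close>, a choice
  for which the resulting bound tends to 0 with \<open>x\<close>.\<close>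

lemma neg_mult_ln_le_sqrt: fixes x :: real assumes "0 \<le> x" shows "- (x * ln x) \<le> 2 * sqrt x"
proof (cases "x = 0")
  case False
  with assms have x: "0 < x" by simp
  have "ln (1 / sqrt x) \<le> 1 / sqrt x"
    using x ln_le_minus_one[of "1 / sqrt x"] by simp
  then have "2 * x * ln (1 / sqrt x) \<le> 2 * x * (1 / sqrt x)"
    using x by (intro mult_left_mono) auto
  moreover have "2 * x * ln (1 / sqrt x) = - (x * ln x)"
    using x by (simp add: ln_div ln_sqrt)
  moreover have "x * (1 / sqrt x) = sqrt x"
    using x by (simp add: real_div_sqrt)
  ultimately show ?thesis by simp
qed simp

text \<open>A crude substitute for Fano's inequality. Up to the factor \<open>1 / ln b\<close>, the
  likely value \<open>z\<close> contributes at most \<open>1 - p z \<le> e\<close> and every other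
  value at most \<open>2 * sqrt e\<close>; for a bounded number of values the total vanishes as
  \<open>e\<close> tends to 0.\<close>

lemma (in information_space) entropy_le_rare:
  fixes Z :: "'a \<Rightarrow> 'c"
  assumes Z: "simple_function M Z" and e: "prob {\<omega> \<in> space M. Z \<omega> \<noteq> z} \<le> e"
  shows "\<H>(Z) \<le> (e + real (card (Z ` space M)) * (2 * sqrt e)) / ln b"
proof -
  define p where "p a = prob (Z -` {a} \<inter> space M)" for a
  have p0: "0 \<le> p a" and p1: "p a \<le> 1" for a by (auto simp: p_def)
  have fin: "finite (Z ` space M)" using Z by (simp add: simple_function_def)
  have ev: "Z -` A \<inter> space M \<in> events" for A by (rule simple_functionD(2)[OF Z])
  have "{\<omega> \<in> space M. Z \<omega> \<noteq> z} = space M - (Z -` {z} \<inter> space M)" by auto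
  then have pz: "1 - p z \<le> e"
    using e prob_compl[OF ev, of "{z}"] by (simp add: p_def)
  have e0: "0 \<le> e" using e measure_nonneg order_trans by blast
  have pe: "p a \<le> e" if "a \<noteq> z" for a
  proof -
    have "p a \<le> prob {\<omega> \<in> space M. Z \<omega> \<noteq> z}"
      unfolding p_def using that ev[of "- {z}"]
      by (intro finite_measure_mono) (auto simp: vimage_def Int_def conj_commute)
    with e show ?thesis by simp
  qed
  have "- (\<Sum>a\<in>Z ` space M. p a * ln (p a)) = (\<Sum>a\<in>Z ` space M. - (p a * ln (p a)))"
    by (simp add: sum_negf)
  also have "\<dots> \<le> (\<Sum>a\<in>Z ` space M. (if a = z then e else 0) + 2 * sqrt e)"
  proof (rule sum_mono)
    fix a
    show "- (p a * ln (p a)) \<le> (if a = z then e else 0) + 2 * sqrt e"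
    proof (cases "a = z")
      case True
      have "- (p z * ln (p z)) \<le> 1 - p z"
      proof (cases "p z = 0")
        case False
        then have "0 < p z" using p0[of z] by simp
        then have "p z * ln (1 / p z) \<le> p z * (1 / p z - 1)"
          by (intro mult_left_mono ln_le_minus_one) auto
        then show ?thesis using \<open>0 < p z\<close> by (simp add: ln_div algebra_simps)
      qed simp
      also have "\<dots> \<le> e" by (rule pz)
      also have "\<dots> \<le> e + 2 * sqrt e" using e0 by simp
      finally show ?thesis using True by simp
    next
      case False
      then have "sqrt (p a) \<le> sqrt e" using pe by (intro real_sqrt_le_mono)
      with neg_mult_ln_le_sqrt[OF p0, of a] have "- (p a * ln (p a)) \<le> 2 * sqrt e" by linarith
      with False show ?thesis by simp
    qed
  qed
  also have "\<dots> \<le> e + real (card (Z ` space M)) * (2 * sqrt e)"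
    using fin e0 by (simp add: sum.distrib sum.delta')
  finally have "- (\<Sum>a\<in>Z ` space M. p a * ln (p a)) / ln b
      \<le> (e + real (card (Z ` space M)) * (2 * sqrt e)) / ln b"
    using b_gt_1 by (intro divide_right_mono) auto
  moreover have "\<H>(Z) = - (\<Sum>a\<in>Z ` space M. p a * ln (p a)) / ln b"
    by (subst entropy_simple_distributed[OF simple_distributedI[OF Z p0]])
      (auto simp: p_def log_def sum_divide_distrib)
  ultimately show ?thesis by simp
qed

lemma (in information_space) entropy_Pair_le:
  assumes "simple_function M X" "simple_function M Y"
  shows "\<H>(\<lambda>x. (X x, Y x)) \<le> \<H>(X) + \<H>(Y)"
  using entropy_chain_rule[OF assms] conditional_entropy_less_eq_entropy[OF assms(2,1)] by simp

text \<open>In each summand of the mutual information the logarithm is taken at 1 or its coefficient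
  is 0; the chain rule turns \<open>\<I>(Y ; X) = 0\<close> into additivity.\<close>

lemma (in information_space) entropy_Pair_indep:
  assumes X: "simple_function M X" and Y: "simple_function M Y"
    and indep: "\<And>a c. prob {\<omega> \<in> space M. X \<omega> = a \<and> Y \<omega> = c}
      = prob {\<omega> \<in> space M. X \<omega> = a} * prob {\<omega> \<in> space M. Y \<omega> = c}"
  shows "\<H>(\<lambda>x. (X x, Y x)) = \<H>(X) + \<H>(Y)"
proof -
  note sX = simple_distributedI[OF X measure_nonneg refl]
    and sY = simple_distributedI[OF Y measure_nonneg refl]
    and sYX = simple_distributedI[OF simple_function_Pair[OF Y X] measure_nonneg refl]
  have "\<I>(Y ; X) = 0"
    unfolding mutual_information_simple_distributed[OF sY sX sYX]
  proof (rule sum.neutral, safe)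
    fix \<omega> assume "\<omega> \<in> space M"
    have *: "(\<lambda>\<omega>. (Y \<omega>, X \<omega>)) -` {(Y \<omega>, X \<omega>)} \<inter> space M
        = {\<omega>' \<in> space M. X \<omega>' = X \<omega> \<and> Y \<omega>' = Y \<omega>}"
      "X -` {X \<omega>} \<inter> space M = {\<omega>' \<in> space M. X \<omega>' = X \<omega>}"
      "Y -` {Y \<omega>} \<inter> space M = {\<omega>' \<in> space M. Y \<omega>' = Y \<omega>}"
      by auto
    show "prob ((\<lambda>\<omega>. (Y \<omega>, X \<omega>)) -` {(Y \<omega>, X \<omega>)} \<inter> space M) *
        log b (prob ((\<lambda>\<omega>. (Y \<omega>, X \<omega>)) -` {(Y \<omega>, X \<omega>)} \<inter> space M) /
          (prob (Y -` {Y \<omega>} \<inter> space M) * prob (X -` {X \<omega>} \<inter> space M))) = 0"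
      unfolding * indep by simp
  qed
  then show ?thesis
    using entropy_chain_rule[OF X Y] mutual_information_eq_entropy_conditional_entropy[OF Y X] by simp
qed

text \<open>The value 0 means that the guess \<open>g (K, W)\<close> is right; otherwise
  \<open>Suc t\<close> reveals the true value \<open>t\<close> of \<open>T\<close>. Thus this error
  variable, together with \<open>K\<close> and \<open>W\<close>, determines
  \<open>T\<close>.\<close>

lemma simple_function_error:
  assumes "simple_function M T" "simple_function M K" "simple_function M W"
  shows "simple_function M (\<lambda>\<omega>. if T \<omega> = g (K \<omega>, W \<omega>) then 0 else Suc (T \<omega>))"
  using simple_function_compose1[OF simple_function_Pair[OF assms(1) simple_function_Pair[OF assms(2,3)]],
      of "\<lambda>(t, k, w). if t = g (k, w) then 0 else Suc t"] by simp

text \<open>With \<open>Z\<close> the error variable, \<open>(T, W)\<close> is a function of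
  \<open>(Z, K, W)\<close>. Independence and subadditivity give
  \<open>\<H>(T) + \<H>(W) \<le> \<H>(Z) + \<H>(K) + \<H>(W)\<close>, and the finite number
  \<open>\<H>(W)\<close> cancels.\<close>

lemma (in information_space) entropy_le_entropy_plus_error:
  fixes T :: "'a \<Rightarrow> nat"
  assumes T: "simple_function M T" and K: "simple_function M K" and W: "simple_function M W"
    and indep: "\<And>t w. prob {\<omega> \<in> space M. T \<omega> = t \<and> W \<omega> = w}
      = prob {\<omega> \<in> space M. T \<omega> = t} * prob {\<omega> \<in> space M. W \<omega> = w}"
  shows "\<H>(T) \<le> \<H>(K) + \<H>(\<lambda>\<omega>. if T \<omega> = g (K \<omega>, W \<omega>) then 0 else Suc (T \<omega>))"
proof -
  define Z where "Z = (\<lambda>\<omega>. if T \<omega> = g (K \<omega>, W \<omega>) then 0 else Suc (T \<omega>))"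
  have Z: "simple_function M Z"
    unfolding Z_def by (rule simple_function_error[OF T K W])
  have "\<H>(T) + \<H>(W) = \<H>(\<lambda>\<omega>. (T \<omega>, W \<omega>))"
    by (rule entropy_Pair_indep[OF T W indep, symmetric])
  also have "(\<lambda>\<omega>. (T \<omega>, W \<omega>))
      = (\<lambda>(z, k, w). (if z = 0 then g (k, w) else z - 1, w)) \<circ> (\<lambda>\<omega>. (Z \<omega>, K \<omega>, W \<omega>))"
    by (auto simp: Z_def fun_eq_iff)
  also have "\<H>(\<dots>) \<le> \<H>(\<lambda>\<omega>. (Z \<omega>, K \<omega>, W \<omega>))"
    by (intro entropy_data_processing simple_function_Pair Z K W)
  also have "\<dots> \<le> \<H>(Z) + \<H>(\<lambda>\<omega>. (K \<omega>, W \<omega>))"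
    by (intro entropy_Pair_le Z simple_function_Pair K W)
  also have "\<dots> \<le> \<H>(Z) + (\<H>(K) + \<H>(W))"
    by (intro add_left_mono entropy_Pair_le K W)
  finally show ?thesis by (simp add: Z_def)
qed

section \<open>Approximation of sets and functions on a product by quantized coordinates\<close>

text \<open>The common refinement of two partitions; the pair of cells is coded as one number
  because quantizers are \<open>nat\<close>-valued.\<close>

lemma quantizers_Pair:
  assumes "q \<in> quantizers N" "q' \<in> quantizers N"
  shows "(\<lambda>y. prod_encode (q y, q' y)) \<in> quantizers N"
  using assms simple_function_compose1[OF simple_function_Pair, of N q q' prod_encode]
  by (simp add: quantizers_def)

lemma sets_prod_quantized:
  assumes "sets \<mu> = sets (N1 \<Otimes>\<^sub>M N2)" "F \<in> sets \<mu>" "q \<in> quantizers N1" "r \<in> quantizers N2"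
  shows "{p \<in> space \<mu>. (p \<in> F) \<noteq> ((q (fst p), r (snd p)) \<in> G)} \<in> sets \<mu>"
proof -
  have [measurable]: "F \<in> sets (N1 \<Otimes>\<^sub>M N2)" using assms by simp
  have [measurable]: "q \<in> N1 \<rightarrow>\<^sub>M count_space UNIV" "r \<in> N2 \<rightarrow>\<^sub>M count_space UNIV"
    using assms by (auto simp: quantizers_def measurable_simple_function)
  have [measurable]: "(\<lambda>p. (q (fst p), r (snd p))) \<in> N1 \<Otimes>\<^sub>M N2 \<rightarrow>\<^sub>M count_space UNIV"
    by measurable
  have "{p \<in> space (N1 \<Otimes>\<^sub>M N2). (p \<in> F) \<noteq> ((q (fst p), r (snd p)) \<in> G)} \<in> sets (N1 \<Otimes>\<^sub>M N2)"
    by measurable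
  then show ?thesis
    using assms(1) by (simp add: sets_eq_imp_space_eq[OF assms(1)])
qed

text \<open>The approximable sets contain the rectangles and are closed under complements and finite
  unions; continuity of the finite measure adds countable unions, hence the whole product
  sigma-algebra.\<close>

lemma approx_by_quantizers:
  assumes "finite_measure \<mu>" and sets: "sets \<mu> = sets (N1 \<Otimes>\<^sub>M N2)" and "F \<in> sets \<mu>"
    and "0 < (e::real)"
  shows "\<exists>q\<in>quantizers N1. \<exists>r\<in>quantizers N2. \<exists>G.
    measure \<mu> {p \<in> space \<mu>. (p \<in> F) \<noteq> ((q (fst p), r (snd p)) \<in> G)} < e"
proof -
  interpret finite_measure \<mu> by fact
  note space = sets_eq_imp_space_eq[OF sets]
  note meas = sets_prod_quantized[OF sets]
  define err where
    "err F q r G = {p \<in> space \<mu>. (p \<in> F) \<noteq> ((q (fst p), r (snd p)) \<in> G)}" for F q r and G :: "(nat \<times> nat) set"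
  define appr where "appr F \<longleftrightarrow> F \<in> sets \<mu> \<and> (\<forall>e>0. \<exists>q\<in>quantizers N1. \<exists>r\<in>quantizers N2. \<exists>G.
    measure \<mu> (err F q r G) < e)" for F
  have const: "(\<lambda>_. 0) \<in> quantizers N" for N :: "'z measure"
    by (simp add: quantizers_def)
  have empty: "appr {}"
    unfolding appr_def
    by (intro conjI allI impI bexI[OF _ const] exI[of _ "{}"]) (auto simp: err_def)
  have union: "appr (F \<union> F')" if "appr F" "appr F'" for F F'
    unfolding appr_def
  proof (intro conjI allI impI)
    show "F \<union> F' \<in> sets \<mu>" using that by (auto simp: appr_def)
    fix e :: real assume "0 < e"
    then have "0 < e / 2" by simp
    with that(1) obtain q r G where 1: "q \<in> quantizers N1" "r \<in> quantizers N2"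
      "measure \<mu> (err F q r G) < e / 2" unfolding appr_def by blast
    from that(2) \<open>0 < e / 2\<close> obtain q' r' G' where 2: "q' \<in> quantizers N1" "r' \<in> quantizers N2"
      "measure \<mu> (err F' q' r' G') < e / 2" unfolding appr_def by blast
    let ?q = "\<lambda>y. prod_encode (q y, q' y)" and ?r = "\<lambda>y. prod_encode (r y, r' y)"
    \<comment> \<open>\<open>?G\<close> reads the two original cells off the refined ones, so an
      error for the union is an error for \<open>F\<close> or for \<open>F'\<close>.\<close>
    let ?G = "{(a, b). (fst (prod_decode a), fst (prod_decode b)) \<in> G
      \<or> (snd (prod_decode a), snd (prod_decode b)) \<in> G'}"
    have "measure \<mu> (err (F \<union> F') ?q ?r ?G) \<le> measure \<mu> (err F q r G \<union> err F' q' r' G')"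
      using that 1 2 unfolding err_def appr_def
      by (intro finite_measure_mono sets.Un meas) auto
    also have "\<dots> \<le> measure \<mu> (err F q r G) + measure \<mu> (err F' q' r' G')"
      using that 1 2 unfolding err_def appr_def
      by (intro measure_Un_le meas) auto
    also have "\<dots> < e" using 1 2 by simp
    finally show "\<exists>q\<in>quantizers N1. \<exists>r\<in>quantizers N2. \<exists>G. measure \<mu> (err (F \<union> F') q r G) < e"
      using quantizers_Pair[OF 1(1) 2(1)] quantizers_Pair[OF 1(2) 2(2)] by blast
  qed
  have compl: "appr (space \<mu> - F)" if "appr F" for F
    unfolding appr_def
  proof (intro conjI allI impI)
    show "space \<mu> - F \<in> sets \<mu>" using that by (auto simp: appr_def)
    fix e :: real assume "0 < e"
    with that obtain q r G where 1: "q \<in> quantizers N1" "r \<in> quantizers N2"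
      "measure \<mu> (err F q r G) < e" unfolding appr_def by blast
    moreover have "err (space \<mu> - F) q r (- G) = err F q r G"
      by (auto simp: err_def)
    ultimately show "\<exists>q\<in>quantizers N1. \<exists>r\<in>quantizers N2. \<exists>G. measure \<mu> (err (space \<mu> - F) q r G) < e"
      by metis
  qed
  have F: "F \<in> sigma_sets (space N1 \<times> space N2) {A \<times> B |A B. A \<in> sets N1 \<and> B \<in> sets N2}"
    using assms(3) by (simp add: sets sets_pair_measure)
  have "appr F"
    using F
  proof induction
    case (Basic F)
    then obtain A B where AB: "F = A \<times> B" "A \<in> sets N1" "B \<in> sets N2" by auto
    have q: "indicator A \<in> quantizers N1" "indicator B \<in> quantizers N2"
      using AB by (auto simp: quantizers_def)
    \<comment> \<open>A rectangle is approximated without error: it is the cell where both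
      indicators are 1.\<close>
    have "err F (indicator A) (indicator B) {(1, 1)} = {}"
      unfolding err_def AB(1) by (auto simp: indicator_def split: if_splits)
    then show ?case
      unfolding appr_def using AB
      by (intro conjI allI impI bexI[OF _ q(1)] bexI[OF _ q(2)] exI[of _ "{(1, 1)}"]) (auto simp: sets)
  next
    case Empty
    show ?case by (rule empty)
  next
    case (Compl F)
    then show ?case using compl[of F] by (simp add: space space_pair_measure)
  next
    case (Union A)
    then have A[measurable]: "A i \<in> sets \<mu>" for i by (auto simp: appr_def)
    have fin: "appr (\<Union>i<n. A i)" for n :: nat
      by (induction n) (auto simp: empty lessThan_Suc intro: union Union)
    show ?case
      unfolding appr_def
    proof (intro conjI allI impI)
      show "(\<Union>i. A i) \<in> sets \<mu>" by measurable
      fix e :: real assume "0 < e"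
      \<comment> \<open>Finite partial unions exhaust the countable union: half of \<open>e\<close>
        pays for the missing tail, the other half for approximating the partial union.\<close>
      have "(\<lambda>n. measure \<mu> (\<Union>i<n. A i)) \<longlonglongrightarrow> measure \<mu> (\<Union>n. \<Union>i<n. A i)"
        by (rule finite_Lim_measure_incseq) (auto simp: incseq_def intro: order.strict_trans2)
      also have "(\<Union>n. \<Union>i<n. A i) = (\<Union>i. A i)" by auto
      finally have "\<forall>\<^sub>F n in sequentially. measure \<mu> (\<Union>i. A i) - e / 2 < measure \<mu> (\<Union>i<n. A i)"
        using \<open>0 < e\<close> by (intro order_tendstoD) auto
      then obtain n where n: "measure \<mu> (\<Union>i. A i) - e / 2 < measure \<mu> (\<Union>i<n. A i)"
        by (auto simp: eventually_sequentially)
      have "measure \<mu> ((\<Union>i. A i) - (\<Union>i<n. A i)) = measure \<mu> (\<Union>i. A i) - measure \<mu> (\<Union>i<n. A i)"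
        by (intro finite_measure_Diff) auto
      with n have d: "measure \<mu> ((\<Union>i. A i) - (\<Union>i<n. A i)) < e / 2" by simp
      have "0 < e / 2" using \<open>0 < e\<close> by simp
      with fin[of n] obtain q r G where 1: "q \<in> quantizers N1" "r \<in> quantizers N2"
        "measure \<mu> (err (\<Union>i<n. A i) q r G) < e / 2" unfolding appr_def by blast
      have m: "err (\<Union>i<n. A i) q r G \<in> sets \<mu>"
        unfolding err_def using 1 by (intro meas) auto
      have "measure \<mu> (err (\<Union>i. A i) q r G)
          \<le> measure \<mu> (((\<Union>i. A i) - (\<Union>i<n. A i)) \<union> err (\<Union>i<n. A i) q r G)"
        using m by (intro finite_measure_mono) (auto simp: err_def)
      also have "\<dots> \<le> measure \<mu> ((\<Union>i. A i) - (\<Union>i<n. A i)) + measure \<mu> (err (\<Union>i<n. A i) q r G)"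
        using m by (intro measure_Un_le) auto
      also have "\<dots> < e" using 1 d by simp
      finally show "\<exists>q\<in>quantizers N1. \<exists>r\<in>quantizers N2. \<exists>G. measure \<mu> (err (\<Union>i. A i) q r G) < e"
        using 1 by blast
    qed
  qed
  with assms(4) show ?thesis
    unfolding appr_def err_def by blast
qed

text \<open>Induction on the bound \<open>m\<close>: the top level set is approximated as a set, and
  the function reset to 0 there has a smaller bound, so the induction hypothesis covers it.\<close>

lemma approx_fun_by_quantizers:
  fixes f :: "'a \<times> 'b \<Rightarrow> nat" and e :: real
  assumes "finite_measure \<mu>" and sets: "sets \<mu> = sets (N1 \<Otimes>\<^sub>M N2)"
    and "f \<in> \<mu> \<rightarrow>\<^sub>M count_space UNIV" "\<And>p. p \<in> space \<mu> \<Longrightarrow> f p \<le> m" "0 < e"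
  shows "\<exists>q\<in>quantizers N1. \<exists>r\<in>quantizers N2. \<exists>g.
    measure \<mu> {p \<in> space \<mu>. f p \<noteq> g (q (fst p), r (snd p))} < e"
  using assms(3-)
proof (induction m arbitrary: f e)
  case 0
  have q: "(\<lambda>_. 0) \<in> quantizers N" for N :: "'z measure"
    by (simp add: quantizers_def)
  have "{p \<in> space \<mu>. f p \<noteq> (\<lambda>_. 0) (0, 0)} = {}" using 0 by auto
  with \<open>0 < e\<close> show ?case
    by (intro bexI[OF _ q] exI[of _ "\<lambda>_. 0"]) (simp only: measure_empty)
next
  case (Suc m)
  interpret finite_measure \<mu> by fact
  note [measurable] = Suc.prems(1)
  define F where "F = {p \<in> space \<mu>. f p = Suc m}"
  have F[measurable]: "F \<in> sets \<mu>" unfolding F_def by measurable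
  let ?f = "\<lambda>p. if f p = Suc m then 0 else f p"
  have e2: "0 < e / 2" using Suc.prems by simp
  have "?f \<in> \<mu> \<rightarrow>\<^sub>M count_space UNIV" by measurable
  moreover have "?f p \<le> m" if "p \<in> space \<mu>" for p
    using Suc.prems(2)[OF that] by auto
  ultimately obtain q r g where 1: "q \<in> quantizers N1" "r \<in> quantizers N2"
    "measure \<mu> {p \<in> space \<mu>. ?f p \<noteq> g (q (fst p), r (snd p))} < e / 2"
    using Suc.IH[OF _ _ e2, of ?f] by blast
  from approx_by_quantizers[OF assms(1) sets F e2] obtain q' r' G where
    2: "q' \<in> quantizers N1" "r' \<in> quantizers N2"
    "measure \<mu> {p \<in> space \<mu>. (p \<in> F) \<noteq> ((q' (fst p), r' (snd p)) \<in> G)} < e / 2"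
    by blast
  let ?q = "\<lambda>y. prod_encode (q y, q' y)" and ?r = "\<lambda>y. prod_encode (r y, r' y)"
  \<comment> \<open>The refined cells first decide membership in the top level set; elsewhere the
    guess for the smaller function is used. It fails only where one of the two approximations
    fails.\<close>
  let ?g = "\<lambda>(a, b). if (snd (prod_decode a), snd (prod_decode b)) \<in> G then Suc m
    else g (fst (prod_decode a), fst (prod_decode b))"
  let ?E = "{p \<in> space \<mu>. ?f p \<noteq> g (q (fst p), r (snd p))}"
    and ?E' = "{p \<in> space \<mu>. (p \<in> F) \<noteq> ((q' (fst p), r' (snd p)) \<in> G)}"
  have [measurable]: "q \<in> N1 \<rightarrow>\<^sub>M count_space UNIV" "r \<in> N2 \<rightarrow>\<^sub>M count_space UNIV"
    using 1 by (auto simp: quantizers_def measurable_simple_function)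
  define h where "h p = g (q (fst p), r (snd p))" for p
  have "h \<in> N1 \<Otimes>\<^sub>M N2 \<rightarrow>\<^sub>M count_space UNIV"
    unfolding h_def by measurable
  then have h[measurable]: "h \<in> \<mu> \<rightarrow>\<^sub>M count_space UNIV"
    by (simp add: measurable_cong_sets[OF sets refl])
  define f' where "f' = ?f"
  have [measurable]: "f' \<in> \<mu> \<rightarrow>\<^sub>M count_space UNIV" unfolding f'_def by measurable
  have "(\<lambda>p. f' p \<noteq> h p) \<in> \<mu> \<rightarrow>\<^sub>M count_space UNIV"
    by (rule measurable_compose_countable[of "\<lambda>n p. n \<noteq> h p" \<mu> "count_space UNIV" f']) measurable
  then have "{p \<in> space \<mu>. f' p \<noteq> h p} \<in> sets \<mu>" by (simp add: pred_def)
  then have E: "?E \<in> sets \<mu>" by (simp only: h_def f'_def)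
  have E': "?E' \<in> sets \<mu>" using 2 by (intro sets_prod_quantized[OF sets]) auto
  have "measure \<mu> {p \<in> space \<mu>. f p \<noteq> ?g (?q (fst p), ?r (snd p))} \<le> measure \<mu> (?E \<union> ?E')"
    using E E' by (intro finite_measure_mono) (auto simp: F_def)
  also have "\<dots> \<le> measure \<mu> ?E + measure \<mu> ?E'"
    using E E' by (rule measure_Un_le)
  also have "\<dots> < e" using 1 2 by simp
  finally have "measure \<mu> {p \<in> space \<mu>. f p \<noteq> ?g (?q (fst p), ?r (snd p))} < e" .
  then show ?case
    by (intro bexI[of _ ?q] bexI[of _ ?r] exI[of _ ?g] quantizers_Pair 1 2)
qed


section \<open>Side information for arbitrary messages\<close>

text \<open>Replacing \<open>f\<close> by a function of quantized \<open>Y\<close> and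
  \<open>V\<close> costs an error of probability below \<open>e\<close>. The finite case then bounds
  \<open>\<H>(T)\<close> by the entropy of a quantized \<open>Y\<close> plus
  \<open>\<phi> e\<close>, and \<open>e\<close> tends to 0.\<close>

lemma (in information_space) entropy_le_SUP_entropy_quantized:
  fixes T :: "'a \<Rightarrow> nat"
  assumes Y[measurable]: "Y \<in> M \<rightarrow>\<^sub>M NY" and V[measurable]: "V \<in> M \<rightarrow>\<^sub>M NV" and T: "simple_function M T"
    and f[measurable]: "f \<in> NY \<Otimes>\<^sub>M NV \<rightarrow>\<^sub>M count_space UNIV"
    and f_le: "\<And>p. p \<in> space (NY \<Otimes>\<^sub>M NV) \<Longrightarrow> f p \<le> m"
    and T_eq: "AE \<omega> in M. T \<omega> = f (Y \<omega>, V \<omega>)"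
    and indep: "\<And>t B. B \<in> sets NV \<Longrightarrow> prob {\<omega> \<in> space M. T \<omega> = t \<and> V \<omega> \<in> B}
      = prob {\<omega> \<in> space M. T \<omega> = t} * prob {\<omega> \<in> space M. V \<omega> \<in> B}"
  shows "ereal (\<H>(T)) \<le> (SUP q\<in>quantizers NY. ereal (\<H>(q \<circ> Y)))" (is "_ \<le> ?S")
proof -
  \<comment> \<open>\<open>c\<close> bounds the number of values of the error variable
    \<open>Z\<close>: the shifted values of \<open>T\<close>, and 0. It does not depend on the
    quantizers, so \<open>\<phi> e\<close> tends to 0 although they change with
    \<open>e\<close>.\<close>
  define c where "c = real (card (T ` space M)) + 1"
  define \<phi> where "\<phi> e = (e + c * (2 * sqrt e)) / ln b" for e
  have approx: "ereal (\<H>(T)) \<le> ?S + ereal (\<phi> e)" if "0 < e" for e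
  proof -
    let ?\<mu> = "distr M (NY \<Otimes>\<^sub>M NV) (\<lambda>\<omega>. (Y \<omega>, V \<omega>))"
    interpret \<mu>: prob_space ?\<mu> by (rule prob_space_distr) measurable
    have "\<exists>q\<in>quantizers NY. \<exists>r\<in>quantizers NV. \<exists>g.
        measure ?\<mu> {p \<in> space ?\<mu>. f p \<noteq> g (q (fst p), r (snd p))} < e"
      using f_le that by (intro approx_fun_by_quantizers[where m=m]) (simp_all add: \<mu>.finite_measure_axioms)
    then obtain q r g where q: "q \<in> quantizers NY" and r: "r \<in> quantizers NV"
      and g: "measure ?\<mu> {p \<in> space ?\<mu>. f p \<noteq> g (q (fst p), r (snd p))} < e"
      by blast
    have [measurable]: "q \<in> NY \<rightarrow>\<^sub>M count_space UNIV" "r \<in> NV \<rightarrow>\<^sub>M count_space UNIV"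
      "T \<in> M \<rightarrow>\<^sub>M count_space UNIV"
      using q r T by (auto simp: quantizers_def measurable_simple_function)
    define K where "K = q \<circ> Y"
    define W where "W = r \<circ> V"
    define Z where "Z = (\<lambda>\<omega>. if T \<omega> = g (K \<omega>, W \<omega>) then 0 else Suc (T \<omega>))"
    have K: "simple_function M K" and W: "simple_function M W"
      using q r simple_function_comp[OF Y, of q] simple_function_comp[OF V, of r]
      by (simp_all add: K_def W_def quantizers_def comp_def)
    have Z: "simple_function M Z"
      unfolding Z_def by (rule simple_function_error[OF T K W])
    have W_sets: "prob {\<omega> \<in> space M. T \<omega> = t \<and> W \<omega> = w}
        = prob {\<omega> \<in> space M. T \<omega> = t} * prob {\<omega> \<in> space M. W \<omega> = w}" for t w
    proof -
      define B where "B = {y \<in> space NV. r y = w}"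
      have "B \<in> sets NV" unfolding B_def by measurable
      moreover have "{\<omega> \<in> space M. T \<omega> = t \<and> V \<omega> \<in> B}
          = {\<omega> \<in> space M. T \<omega> = t \<and> W \<omega> = w}"
        "{\<omega> \<in> space M. V \<omega> \<in> B} = {\<omega> \<in> space M. W \<omega> = w}"
        by (auto simp: W_def B_def dest: measurable_space[OF V])
      ultimately show ?thesis using indep[of B t] by simp
    qed
    have "\<H>(T) \<le> \<H>(K) + \<H>(Z)"
      unfolding Z_def by (rule entropy_le_entropy_plus_error[OF T K W W_sets])
    moreover have "\<H>(Z) \<le> \<phi> e"
    proof -
      define h where "h p = g (q (fst p), r (snd p))" for p
      have [measurable]: "h \<in> NY \<Otimes>\<^sub>M NV \<rightarrow>\<^sub>M count_space UNIV"
        unfolding h_def by measurable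
      have "(\<lambda>p. f p \<noteq> h p) \<in> NY \<Otimes>\<^sub>M NV \<rightarrow>\<^sub>M count_space UNIV"
        by (rule measurable_compose_countable[of "\<lambda>n p. n \<noteq> h p" _ "count_space UNIV" f]) measurable
      then have E[measurable]: "{p \<in> space (NY \<Otimes>\<^sub>M NV). f p \<noteq> h p} \<in> sets (NY \<Otimes>\<^sub>M NV)"
        by (simp add: pred_def)
      have vimage: "(\<lambda>\<omega>. (Y \<omega>, V \<omega>)) -` {p \<in> space (NY \<Otimes>\<^sub>M NV). f p \<noteq> h p} \<inter> space M
          = {\<omega> \<in> space M. f (Y \<omega>, V \<omega>) \<noteq> h (Y \<omega>, V \<omega>)}"
        by (auto simp: space_pair_measure dest: measurable_space[OF Y] measurable_space[OF V])
      \<comment> \<open>\<open>T\<close> agrees with \<open>f (Y, V)\<close> only almost surely, so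
        the two error events are equal up to a null set.\<close>
      have "prob {\<omega> \<in> space M. Z \<omega> \<noteq> 0} = prob {\<omega> \<in> space M. f (Y \<omega>, V \<omega>) \<noteq> h (Y \<omega>, V \<omega>)}"
      proof (rule measure_eq_AE)
        show "AE \<omega> in M. (\<omega> \<in> {\<omega> \<in> space M. Z \<omega> \<noteq> 0})
            = (\<omega> \<in> {\<omega> \<in> space M. f (Y \<omega>, V \<omega>) \<noteq> h (Y \<omega>, V \<omega>)})"
          using T_eq by eventually_elim (auto simp: Z_def K_def W_def h_def)
        have "{\<omega> \<in> space M. Z \<omega> \<noteq> 0} = Z -` (- {0}) \<inter> space M" by auto
        then show "{\<omega> \<in> space M. Z \<omega> \<noteq> 0} \<in> events" using simple_functionD(2)[OF Z] by metis
        show "{\<omega> \<in> space M. f (Y \<omega>, V \<omega>) \<noteq> h (Y \<omega>, V \<omega>)} \<in> events"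
          unfolding vimage[symmetric] by (rule measurable_sets[OF _ E]) measurable
      qed
      also have "\<dots> = measure ?\<mu> {p \<in> space ?\<mu>. f p \<noteq> g (q (fst p), r (snd p))}"
        unfolding vimage[symmetric] h_def[symmetric] space_distr
        by (rule measure_distr[symmetric, OF _ E[folded sets_distr]]) measurable
      also note g
      finally have "\<H>(Z) \<le> (e + real (card (Z ` space M)) * (2 * sqrt e)) / ln b"
        by (intro entropy_le_rare[OF Z, of 0]) simp
      also have "\<dots> \<le> \<phi> e"
      proof -
        have "Z ` space M \<subseteq> insert 0 (Suc ` T ` space M)" by (auto simp: Z_def)
        moreover have fin: "finite (T ` space M)" using T by (simp add: simple_function_def)
        ultimately have "card (Z ` space M) \<le> card (insert 0 (Suc ` T ` space M))"
          by (intro card_mono) auto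
        also have "\<dots> = card (T ` space M) + 1"
          using fin by (simp add: card_image)
        finally have "real (card (Z ` space M)) \<le> c" by (simp add: c_def)
        then show ?thesis
          unfolding \<phi>_def using that b_gt_1 by (intro divide_right_mono add_left_mono mult_right_mono) auto
      qed
      finally show ?thesis .
    qed
    ultimately have "\<H>(T) \<le> \<H>(K) + \<phi> e" by simp
    then have "ereal (\<H>(T)) \<le> ereal (\<H>(K)) + ereal (\<phi> e)" by simp
    also have "\<dots> \<le> ?S + ereal (\<phi> e)"
      unfolding K_def by (intro add_right_mono SUP_upper q)
    finally show ?thesis .
  qed
  show ?thesis
  proof (rule ereal_le_epsilon2)
    fix d :: real assume "0 < d"
    have "(\<phi> \<longlongrightarrow> (0 + c * (2 * sqrt 0)) / ln b) (at_right 0)"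
      unfolding \<phi>_def using b_gt_1 by (intro tendsto_intros) auto
    then have "\<forall>\<^sub>F e in at_right 0. \<phi> e < d"
      using \<open>0 < d\<close> by (intro order_tendstoD) auto
    then obtain e where "0 < e" "\<phi> e < d"
      by (metis eventually_at_right_field dense)
    then have "?S + ereal (\<phi> e) \<le> ?S + ereal d"
      by (intro add_left_mono) simp
    with approx[OF \<open>0 < e\<close>] show "ereal (\<H>(T)) \<le> ?S + ereal d"
      by (rule order_trans)
  qed
qed

section \<open>Aggregation protocols\<close>

text \<open>Only the sigma-algebra matters here: it is shared by \<open>joint \<Q> P\<close> for all
  data laws \<open>P\<close>, so measurability is proved once for all of them.\<close>

definition sample_space ::
    "('x, 't, 'y, 'h) protocol \<Rightarrow> ((nat \<Rightarrow> 'x) \<times> (nat \<Rightarrow> 't)) measure" where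
  "sample_space \<Q> = PiM (all_users \<Q>) (\<lambda>_. data_space \<Q>) \<Otimes>\<^sub>M secret_law \<Q>"

text \<open>The partial view \<open>V\<close> of the outline. The second-round answer stays in it,
  being a function of the secrets alone.\<close>

definition rest_view ::
    "('x, 't, 'y, 'h) protocol \<Rightarrow> nat set \<Rightarrow> nat \<Rightarrow>
     (nat \<Rightarrow> 'x) \<times> (nat \<Rightarrow> 't) \<Rightarrow> (nat \<Rightarrow> 'y) \<times> 'h" where
  "rest_view \<Q> \<D> i = (\<lambda>\<omega>. (\<lambda>j\<in>all_users \<Q> - \<D> - {i}. msg \<Q> j \<omega>, round2 \<Q> (snd \<omega>) \<D>))"

abbreviation rest_space ::
    "('x, 't, 'y, 'h) protocol \<Rightarrow> nat set \<Rightarrow> nat \<Rightarrow> ((nat \<Rightarrow> 'y) \<times> 'h) measure" where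
  "rest_space \<Q> \<D> i \<equiv> PiM (all_users \<Q> - \<D> - {i}) (msg_space \<Q>) \<Otimes>\<^sub>M round2_space \<Q> \<D>"

text \<open>A fair coin chooses between two data vectors. Security is required for every data law,
  so it may be tested on this one.\<close>

definition two_point :: "('x, 't, 'y, 'h) protocol \<Rightarrow> (nat \<Rightarrow> 'x) \<Rightarrow> (nat \<Rightarrow> 'x) \<Rightarrow> (nat \<Rightarrow> 'x) measure" where
  "two_point \<Q> x x' = distr (measure_pmf (bernoulli_pmf (1 / 2)))
     (PiM (all_users \<Q>) (\<lambda>_. data_space \<Q>)) (\<lambda>b. if b then x else x')"

context
  fixes \<Q> :: "('x::ab_group_add, 't, 'y, 'h) protocol"
  assumes protocol: "aggregation_protocol \<Q>"
begin

interpretation L: prob_space "secret_law \<Q>"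
  using protocol by (simp add: aggregation_protocol_def)

abbreviation "DX \<equiv> PiM (all_users \<Q>) (\<lambda>_. data_space \<Q>)"

section \<open>Measurability of the variables of a protocol\<close>

lemma finite_users: "finite (all_users \<Q>)"
  by (simp add: all_users_def)

lemma measurable_msg:
  assumes i: "i \<in> all_users \<Q>"
  shows "msg \<Q> i \<in> sample_space \<Q> \<rightarrow>\<^sub>M msg_space \<Q> i"
proof -
  have L: "sets (secret_law \<Q>) = sets (PiM (all_users \<Q>) (secret_space \<Q>))"
    and [measurable]: "(\<lambda>(x, t). enc \<Q> i x t) \<in> data_space \<Q> \<Otimes>\<^sub>M secret_space \<Q> i \<rightarrow>\<^sub>M msg_space \<Q> i"
    using protocol i by (auto simp: aggregation_protocol_def)
  have [measurable]: "(\<lambda>\<theta>. \<theta> i) \<in> secret_law \<Q> \<rightarrow>\<^sub>M secret_space \<Q> i"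
    unfolding measurable_cong_sets[OF L refl] using i by measurable
  have "(\<lambda>\<omega>. (\<lambda>(x, t). enc \<Q> i x t) (fst \<omega> i, snd \<omega> i)) \<in> sample_space \<Q> \<rightarrow>\<^sub>M msg_space \<Q> i"
    unfolding sample_space_def using i by measurable
  then show ?thesis by (simp add: msg_def case_prod_beta')
qed

lemma measurable_round2:
  "\<D> \<subseteq> all_users \<Q> \<Longrightarrow> (\<lambda>\<omega>. round2 \<Q> (snd \<omega>) \<D>) \<in> sample_space \<Q> \<rightarrow>\<^sub>M round2_space \<Q> \<D>"
  using protocol unfolding aggregation_protocol_def sample_space_def
  by (intro measurable_compose[OF measurable_snd, of "\<lambda>\<theta>. round2 \<Q> \<theta> \<D>"]) auto

lemma measurable_server_view:
  "\<D> \<subseteq> all_users \<Q> \<Longrightarrow> server_view \<Q> \<D> \<in> sample_space \<Q> \<rightarrow>\<^sub>M view_space \<Q> \<D>"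
  unfolding server_view_def view_space_def
  by (intro measurable_Pair measurable_restrict measurable_msg measurable_round2) auto

lemma measurable_rest_view:
  "\<D> \<subseteq> all_users \<Q> \<Longrightarrow> rest_view \<Q> \<D> i \<in> sample_space \<Q> \<rightarrow>\<^sub>M rest_space \<Q> \<D> i"
  unfolding rest_view_def
  by (intro measurable_Pair measurable_restrict measurable_msg measurable_round2) auto

lemma measurable_data:
  assumes "A \<subseteq> all_users \<Q>"
  shows "data A \<in> sample_space \<Q> \<rightarrow>\<^sub>M PiM A (\<lambda>_. data_space \<Q>)"
proof -
  have "(\<lambda>\<omega>. restrict (fst \<omega>) A) \<in> sample_space \<Q> \<rightarrow>\<^sub>M PiM A (\<lambda>_. data_space \<Q>)"
    unfolding sample_space_def
    by (intro measurable_compose[OF measurable_fst] measurable_restrict_subset assms)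
  then show ?thesis by (simp add: data_def case_prod_beta')
qed

lemma measurable_sum:
  "A \<subseteq> all_users \<Q> \<Longrightarrow> (\<lambda>x. \<Sum>i\<in>A. x i) \<in> DX \<rightarrow>\<^sub>M sum_space \<Q>"
  using protocol by (simp add: aggregation_protocol_def)

lemma measurable_data_sum:
  assumes "A \<subseteq> all_users \<Q>"
  shows "data_sum A \<in> sample_space \<Q> \<rightarrow>\<^sub>M sum_space \<Q>"
proof -
  have "(\<lambda>\<omega>. \<Sum>i\<in>A. fst \<omega> i) \<in> sample_space \<Q> \<rightarrow>\<^sub>M sum_space \<Q>"
    unfolding sample_space_def
    by (rule measurable_compose[OF measurable_fst measurable_sum[OF assms]])
  then show ?thesis by (simp add: data_sum_def case_prod_beta')
qed

section \<open>Joint laws of data and secrets\<close>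

lemma sets_joint: "P \<in> data_laws \<Q> \<Longrightarrow> sets (joint \<Q> P) = sets (sample_space \<Q>)"
  unfolding joint_def sample_space_def data_laws_def by (intro sets_pair_measure_cong) auto

lemma measurable_joint:
  "P \<in> data_laws \<Q> \<Longrightarrow> f \<in> sample_space \<Q> \<rightarrow>\<^sub>M N \<Longrightarrow> f \<in> joint \<Q> P \<rightarrow>\<^sub>M N"
  by (simp add: measurable_cong_sets[OF sets_joint refl])

lemma prob_space_joint:
  assumes "P \<in> data_laws \<Q>"
  shows "prob_space (joint \<Q> P)"
proof -
  interpret Pr: prob_space P using assms by (simp add: data_laws_def)
  interpret pair_prob_space P "secret_law \<Q>" ..
  show ?thesis unfolding joint_def by (rule P.prob_space_axioms)
qed

lemma two_point_data_laws:
  assumes "x \<in> space DX" "x' \<in> space DX"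
  shows "two_point \<Q> x x' \<in> data_laws \<Q>"
  using assms by (auto simp: two_point_def data_laws_def intro!: measure_pmf.prob_space_distr)

text \<open>By Fubini the probability is the integral of the section probabilities, and the fair
  coin averages the two sections.\<close>

lemma measure_joint_two_point:
  assumes x: "x \<in> space DX" "x' \<in> space DX" and E: "E \<in> sets (sample_space \<Q>)"
  shows "measure (joint \<Q> (two_point \<Q> x x')) E
    = (L.prob (Pair x -` E) + L.prob (Pair x' -` E)) / 2"
proof -
  have E': "E \<in> sets (DX \<Otimes>\<^sub>M secret_law \<Q>)" using E by (simp add: sample_space_def)
  have m: "(\<lambda>b. if b then x else x') \<in> measure_pmf (bernoulli_pmf (1 / 2)) \<rightarrow>\<^sub>M DX"
    using x by auto
  have "emeasure (joint \<Q> (two_point \<Q> x x')) E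
      = (\<integral>\<^sup>+y. emeasure (secret_law \<Q>) (Pair y -` E) \<partial>two_point \<Q> x x')"
    unfolding joint_def using E sets_joint[OF two_point_data_laws[OF x]]
    by (intro L.emeasure_pair_measure_alt) (simp add: joint_def)
  also have "\<dots> = (\<integral>\<^sup>+b. emeasure (secret_law \<Q>) (Pair (if b then x else x') -` E) \<partial>bernoulli_pmf (1 / 2))"
    unfolding two_point_def using L.measurable_emeasure_Pair[OF E']
    by (intro nn_integral_distr m) simp
  also have "\<dots> = ennreal (L.prob (Pair x -` E)) * ennreal (1 / 2) + ennreal (L.prob (Pair x' -` E)) * ennreal (1 - 1 / 2)"
    by (subst nn_integral_bernoulli_pmf) (simp_all add: L.emeasure_eq_measure)
  also have "\<dots> = ennreal (L.prob (Pair x -` E) * (1 / 2)) + ennreal (L.prob (Pair x' -` E) * (1 - 1 / 2))"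
    by (intro arg_cong2[where f="(+)"] ennreal_mult[symmetric]) simp_all
  also have "\<dots> = ennreal (L.prob (Pair x -` E) * (1 / 2) + L.prob (Pair x' -` E) * (1 - 1 / 2))"
    by (rule ennreal_plus[symmetric]) simp_all
  also have "\<dots> = ennreal ((L.prob (Pair x -` E) + L.prob (Pair x' -` E)) / 2)"
    by (rule arg_cong[where f=ennreal]) (simp add: field_simps)
  finally show ?thesis
    by (simp add: measure_def)
qed

section \<open>Consequences of the first security constraint\<close>

text \<open>Under the two-point law the sum is constant, so security makes view and data
  independent. If the two view laws differed on \<open>A\<close>, some data event would contain
  \<open>x\<close> but not \<open>x'\<close>, and independence from that event contradicts the
  difference.\<close>

lemma view_law_depends_on_sum:
  assumes sec: "secure_given_sum \<Q>" and D: "\<D> \<subseteq> all_users \<Q>"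
    and x: "x \<in> space DX" "x' \<in> space DX"
    and sum: "(\<Sum>i\<in>all_users \<Q> - \<D>. x i) = (\<Sum>i\<in>all_users \<Q> - \<D>. x' i)"
    and A: "A \<in> sets (view_space \<Q> \<D>)"
  shows "L.prob {\<theta> \<in> space (secret_law \<Q>). server_view \<Q> \<D> (x, \<theta>) \<in> A}
    = L.prob {\<theta> \<in> space (secret_law \<Q>). server_view \<Q> \<D> (x', \<theta>) \<in> A}"
proof (rule ccontr)
  let ?U = "all_users \<Q> - \<D>" and ?P = "two_point \<Q> x x'"
  let ?DU = "PiM ?U (\<lambda>_. data_space \<Q>)"
  define \<kappa> where "\<kappa> y = L.prob {\<theta> \<in> space (secret_law \<Q>). server_view \<Q> \<D> (y, \<theta>) \<in> A}" for y
  assume "\<not> ?thesis"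
  then have neq: "\<kappa> x \<noteq> \<kappa> x'" by (simp add: \<kappa>_def)
  have U: "?U \<subseteq> all_users \<Q>" by auto
  have Pl: "?P \<in> data_laws \<Q>" by (rule two_point_data_laws[OF x])
  interpret J: prob_space "joint \<Q> ?P" by (rule prob_space_joint[OF Pl])
  interpret J: information_space "joint \<Q> ?P" 2 by standard simp
  note sJ = sets_joint[OF Pl] and spJ = sets_eq_imp_space_eq[OF sets_joint[OF Pl]]
  note mv = measurable_server_view[OF D] and md = measurable_data[OF U] and ms = measurable_data_sum[OF U]

  text \<open>If the two data vectors had distinct view laws, these laws would separate them measurably.\<close>
  define ext where "ext y = (\<lambda>j\<in>all_users \<Q>. if j \<in> ?U then y j else x j)" for y
  have ext: "ext \<in> ?DU \<rightarrow>\<^sub>M DX"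
    unfolding ext_def
  proof (rule measurable_restrict)
    fix j assume j: "j \<in> all_users \<Q>"
    show "(\<lambda>y. if j \<in> ?U then y j else x j) \<in> ?DU \<rightarrow>\<^sub>M data_space \<Q>"
      using x(1) j by (cases "j \<in> ?U") (auto simp: space_PiM PiE_iff)
  qed
  have EA: "server_view \<Q> \<D> -` A \<inter> space (sample_space \<Q>) \<in> sets (sample_space \<Q>)"
    by (rule measurable_sets[OF mv A])
  have \<kappa>_alt: "ennreal (\<kappa> y) = emeasure (secret_law \<Q>)
      (Pair y -` (server_view \<Q> \<D> -` A \<inter> space (sample_space \<Q>)))" if "y \<in> space DX" for y
    using that unfolding \<kappa>_def L.emeasure_eq_measure sample_space_def
    by (auto simp: space_pair_measure intro!: arg_cong[where f="L.prob"])
  have "(\<lambda>y. emeasure (secret_law \<Q>)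
      (Pair y -` (server_view \<Q> \<D> -` A \<inter> space (sample_space \<Q>)))) \<in> borel_measurable DX"
    using EA unfolding sample_space_def by (rule L.measurable_emeasure_Pair)
  then have "(\<lambda>y. ennreal (\<kappa> y)) \<in> borel_measurable DX"
    by (subst measurable_cong[OF \<kappa>_alt])
  then have "(\<lambda>y. enn2real (ennreal (\<kappa> y))) \<in> borel_measurable DX"
    by (rule borel_measurable_enn2real)
  then have m\<kappa>: "\<kappa> \<in> borel_measurable DX"
    by (simp add: \<kappa>_def[abs_def])
  \<comment> \<open>Singletons of data vectors need not be measurable, so a level set of
    \<open>\<kappa>\<close>, measurable by Fubini, does the separating. Only survivors' data are
    quantized; \<open>ext\<close> fills the other entries from \<open>x\<close>, which leaves the
    view law unchanged.\<close>
  define R where "R = {y \<in> space ?DU. \<kappa> (ext y) = \<kappa> x}"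
  have R: "R \<in> sets ?DU"
    using measurable_sets[OF measurable_compose[OF ext m\<kappa>], of "{\<kappa> x}"]
    by (simp add: R_def vimage_def Int_def conj_commute)
  have ext_restrict: "\<kappa> (ext (restrict y ?U)) = \<kappa> y" for y
    unfolding \<kappa>_def server_view_def msg_def ext_def
    by (intro arg_cong[where f="L.prob"] Collect_cong conj_cong refl arg_cong2[where f="(\<in>)"] arg_cong2[where f=Pair]) auto
  have "restrict y ?U \<in> space ?DU" if "y \<in> space DX" for y
    using that by (auto simp: space_PiM PiE_iff)
  then have R_iff: "restrict x ?U \<in> R" "restrict x' ?U \<notin> R"
    using x neq by (auto simp: R_def ext_restrict)

  \<comment> \<open>The supremum in the security constraint is tested on two-cell partitions: the
    view is split by \<open>A\<close> and the data by \<open>R\<close>.\<close>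
  let ?X = "indicator A \<circ> server_view \<Q> \<D> :: _ \<Rightarrow> nat" and ?Y = "indicator R \<circ> data ?U :: _ \<Rightarrow> nat"
  let ?Z = "data_sum ?U :: _ \<times> (nat \<Rightarrow> 't) \<Rightarrow> 'x"
  let ?CX = "count_space (?X ` space (joint \<Q> ?P))" and ?CY = "count_space (?Y ` space (joint \<Q> ?P))"
  have sX: "simple_function (joint \<Q> ?P) ?X" and sY: "simple_function (joint \<Q> ?P) ?Y"
    using simple_function_comp[OF measurable_joint[OF Pl mv], of "indicator A"]
      simple_function_comp[OF measurable_joint[OF Pl md], of "indicator R"] A R
    by (auto simp: comp_def)
  have fX: "finite (?X ` space (joint \<Q> ?P))" using sX by (simp add: simple_function_def)
  have mX: "?X \<in> joint \<Q> ?P \<rightarrow>\<^sub>M ?CX" and mY: "?Y \<in> joint \<Q> ?P \<rightarrow>\<^sub>M ?CY"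
    using simple_functionD[OF sX] simple_functionD[OF sY] by (auto simp: measurable_def)
  note mZ = measurable_joint[OF Pl ms]
  have "J.conditional_mutual_information 2 ?CX ?CY (sum_space \<Q>) ?X ?Y ?Z \<le> 0"
  proof -
    have "cond_mutual_info (joint \<Q> ?P) (view_space \<Q> \<D>) ?DU (sum_space \<Q>)
        (server_view \<Q> \<D>) (data ?U) ?Z = 0"
      using sec D Pl by (simp add: secure_given_sum_def)
    moreover have "(indicator A, indicator R) \<in> quantizers (view_space \<Q> \<D>) \<times> quantizers ?DU"
      using A R by (auto simp: quantizers_def)
    ultimately have "ereal (J.conditional_mutual_information 2 ?CX ?CY (sum_space \<Q>) ?X ?Y ?Z) \<le> 0"
      unfolding cond_mutual_info_def by (metis (mono_tags, lifting) SUP_upper case_prod_conv)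
    then show ?thesis by simp
  qed
  moreover
  text \<open>The sum is almost surely constant, so conditioning on it has no effect.\<close>
  define s where "s = (\<Sum>i\<in>?U. x i)"
  have Z_sets: "Pair y -` {\<omega> \<in> space (sample_space \<Q>). Q \<omega> \<and> ?Z \<omega> \<in> B}
      = (if s \<in> B then Pair y -` {\<omega> \<in> space (sample_space \<Q>). Q \<omega>} else {})" if "y = x \<or> y = x'" for y Q B
    using that sum by (auto simp: data_sum_def s_def)
  have "J.mutual_information 2 ?CX (sum_space \<Q>) ?X ?Z = 0"
  proof (rule J.mutual_information_eq_0_if_indep[OF mX mZ])
    fix B C assume B: "B \<in> sets ?CX" and C: "C \<in> sets (sum_space \<Q>)"
    have Bm: "{\<omega> \<in> space (sample_space \<Q>). ?X \<omega> \<in> B} \<in> sets (sample_space \<Q>)"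
      using measurable_sets[OF mX B] by (simp add: sJ spJ vimage_def Int_def conj_commute)
    have Cm: "{\<omega> \<in> space (sample_space \<Q>). ?Z \<omega> \<in> C} \<in> sets (sample_space \<Q>)"
      using measurable_sets[OF ms C] by (simp add: vimage_def Int_def conj_commute)
    have BCm: "{\<omega> \<in> space (sample_space \<Q>). ?X \<omega> \<in> B \<and> ?Z \<omega> \<in> C} \<in> sets (sample_space \<Q>)"
      using sets.Int[OF Bm Cm] by (simp add: Collect_conj_eq[symmetric] Int_def conj_ac cong: conj_cong)
    have top: "L.prob (Pair y -` {\<omega> \<in> space (sample_space \<Q>). True}) = 1" if "y = x \<or> y = x'" for y
      using that x L.prob_space by (auto simp: sample_space_def space_pair_measure vimage_def)
    have pC: "L.prob (Pair y -` {\<omega> \<in> space (sample_space \<Q>). ?Z \<omega> \<in> C}) = (if s \<in> C then 1 else 0)"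
      if "y = x \<or> y = x'" for y
      using Z_sets[OF that, of "\<lambda>_. True" C] top[OF that] by simp
    have pBC: "L.prob (Pair y -` {\<omega> \<in> space (sample_space \<Q>). ?X \<omega> \<in> B \<and> ?Z \<omega> \<in> C})
        = (if s \<in> C then L.prob (Pair y -` {\<omega> \<in> space (sample_space \<Q>). ?X \<omega> \<in> B}) else 0)"
      if "y = x \<or> y = x'" for y
      unfolding Z_sets[OF that] by simp
    show "J.prob {\<omega> \<in> space (joint \<Q> ?P). ?X \<omega> \<in> B \<and> ?Z \<omega> \<in> C}
        = J.prob {\<omega> \<in> space (joint \<Q> ?P). ?X \<omega> \<in> B} * J.prob {\<omega> \<in> space (joint \<Q> ?P). ?Z \<omega> \<in> C}"
      unfolding spJ measure_joint_two_point[OF x Bm] measure_joint_two_point[OF x Cm]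
        measure_joint_two_point[OF x BCm] pBC[OF disjI1[OF refl]] pBC[OF disjI2[OF refl]]
        pC[OF disjI1[OF refl]] pC[OF disjI2[OF refl]]
      by (cases "s \<in> C") (simp_all only: if_True if_False, simp_all)
  qed
  \<comment> \<open>Conditional mutual information is defined as
    \<open>I(X; (Y, Z)) - I(X; Z)\<close>, and the second term has just been shown to be 0.\<close>
  ultimately have "J.mutual_information 2 ?CX (?CY \<Otimes>\<^sub>M sum_space \<Q>) ?X (\<lambda>\<omega>. (?Y \<omega>, ?Z \<omega>)) \<le> 0"
    by (simp add: J.conditional_mutual_information_def)
  then have ind: "J.prob {\<omega> \<in> space (joint \<Q> ?P). ?X \<omega> \<in> B \<and> (?Y \<omega>, ?Z \<omega>) \<in> C}
      = J.prob {\<omega> \<in> space (joint \<Q> ?P). ?X \<omega> \<in> B} * J.prob {\<omega> \<in> space (joint \<Q> ?P). (?Y \<omega>, ?Z \<omega>) \<in> C}"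
    if "B \<in> sets ?CX" "C \<in> sets (?CY \<Otimes>\<^sub>M sum_space \<Q>)" for B C
    using J.indep_if_mutual_information_le_0[OF fX mX measurable_Pair[OF mY mZ] _ that] by blast
  define Ev where "Ev = {\<omega> \<in> space (sample_space \<Q>). server_view \<Q> \<D> \<omega> \<in> A}"
  define Er where "Er = {\<omega> \<in> space (sample_space \<Q>). data ?U \<omega> \<in> R}"
  have Ev: "Ev \<in> sets (sample_space \<Q>)" and Er: "Er \<in> sets (sample_space \<Q>)"
    using EA measurable_sets[OF md R] by (auto simp: Ev_def Er_def vimage_def Int_def conj_commute)
  \<comment> \<open>Both indicators are required to be 1, within their ranges because these carry
    the discrete spaces; the sum is left unrestricted.\<close>
  let ?B = "{1} \<inter> ?X ` space (joint \<Q> ?P)"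
    and ?C = "({1} \<inter> ?Y ` space (joint \<Q> ?P)) \<times> space (sum_space \<Q>)"
  have Zs: "?Z \<omega> \<in> space (sum_space \<Q>)" if "\<omega> \<in> space (sample_space \<Q>)" for \<omega>
    using measurable_space[OF ms that] .
  have X1: "?X \<omega> \<in> ?B \<longleftrightarrow> \<omega> \<in> Ev" and Y1: "(?Y \<omega>, ?Z \<omega>) \<in> ?C \<longleftrightarrow> \<omega> \<in> Er"
    if "\<omega> \<in> space (joint \<Q> ?P)" for \<omega>
    using that Zs by (auto simp: spJ Ev_def Er_def indicator_def)
  have "{\<omega> \<in> space (joint \<Q> ?P). ?X \<omega> \<in> ?B \<and> (?Y \<omega>, ?Z \<omega>) \<in> ?C} = Ev \<inter> Er"
    "{\<omega> \<in> space (joint \<Q> ?P). ?X \<omega> \<in> ?B} = Ev"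
    "{\<omega> \<in> space (joint \<Q> ?P). (?Y \<omega>, ?Z \<omega>) \<in> ?C} = Er"
    using X1 Y1 sets.sets_into_space[OF Ev] sets.sets_into_space[OF Er] unfolding spJ by blast+
  moreover have "?B \<in> sets ?CX" "?C \<in> sets (?CY \<Otimes>\<^sub>M sum_space \<Q>)"
    by auto
  ultimately have "J.prob (Ev \<inter> Er) = J.prob Ev * J.prob Er"
    using ind[of ?B ?C] by metis
  moreover have "L.prob (Pair y -` Ev) = \<kappa> y" if "y \<in> space DX" for y
    using that unfolding Ev_def \<kappa>_def sample_space_def
    by (auto simp: space_pair_measure intro!: arg_cong[where f="L.prob"])
  moreover have "Pair x -` Er = space (secret_law \<Q>)" "Pair x' -` Er = {}"
    using R_iff x by (auto simp: Er_def data_def sample_space_def space_pair_measure)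
  moreover have "Pair x -` (Ev \<inter> Er) = Pair x -` Ev" "Pair x' -` (Ev \<inter> Er) = {}"
    using R_iff x by (auto simp: Ev_def Er_def data_def sample_space_def space_pair_measure)
  \<comment> \<open>\<open>Er\<close> holds exactly when the coin selects \<open>x\<close>, so it
    has probability 1/2; the equation is independence of \<open>Ev\<close> and \<open>Er\<close>,
    and it forces \<open>\<kappa> x = \<kappa> x'\<close>.\<close>
  ultimately have "\<kappa> x / 2 = (\<kappa> x + \<kappa> x') / 2 * (1 / 2)"
    using x Ev Er L.prob_space by (simp add: measure_joint_two_point)
  with neq show False by simp
qed

text \<open>Any single entry \<open>j\<close> can be changed if entry \<open>i\<close>, invisible in
  this view, compensates. As the domain need not be closed under addition, the compensation
  exchanges values instead of adding a difference.\<close>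

lemma rest_view_law_const:
  assumes sec: "secure_given_sum \<Q>" and D: "\<D> \<subseteq> all_users \<Q>" and i: "i \<in> all_users \<Q> - \<D>"
    and x: "x \<in> space DX" "x' \<in> space DX" and B: "B \<in> sets (rest_space \<Q> \<D> i)"
  shows "L.prob {\<theta> \<in> space (secret_law \<Q>). rest_view \<Q> \<D> i (x, \<theta>) \<in> B}
    = L.prob {\<theta> \<in> space (secret_law \<Q>). rest_view \<Q> \<D> i (x', \<theta>) \<in> B}"
proof -
  let ?U = "all_users \<Q> - \<D>"
  define \<rho> where "\<rho> y = L.prob {\<theta> \<in> space (secret_law \<Q>). rest_view \<Q> \<D> i (y, \<theta>) \<in> B}" for y
  have fin: "finite ?U" using finite_users by simp
  \<comment> \<open>The data of user \<open>i\<close> enter only the erased message, and the second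
    round depends on the secrets alone.\<close>
  have \<rho>_cong: "\<rho> y = \<rho> y'" if "\<And>j. j \<in> ?U - {i} \<Longrightarrow> y j = y' j" for y y'
  proof -
    have "rest_view \<Q> \<D> i (y, \<theta>) = rest_view \<Q> \<D> i (y', \<theta>)" for \<theta>
      using that by (auto simp: rest_view_def msg_def)
    then show ?thesis by (simp add: \<rho>_def)
  qed
  have \<rho>_sum: "\<rho> y = \<rho> y'"
    if "y \<in> space DX" "y' \<in> space DX" "(\<Sum>j\<in>?U. y j) = (\<Sum>j\<in>?U. y' j)" for y y'
  proof -
    \<comment> \<open>\<open>?r\<close> erases the message of user \<open>i\<close>, so the law of
      the partial view is an image of the law of the full view and inherits its dependence on the
      sum only.\<close>
    let ?r = "\<lambda>p. (restrict (fst p) (?U - {i}), snd p)"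
    have r: "?r \<in> view_space \<Q> \<D> \<rightarrow>\<^sub>M rest_space \<Q> \<D> i"
      unfolding view_space_def
      by (intro measurable_Pair measurable_snd measurable_compose[OF measurable_fst] measurable_restrict_subset) auto
    have sv: "server_view \<Q> \<D> (z, \<theta>) \<in> space (view_space \<Q> \<D>)"
      if "z \<in> space DX" "\<theta> \<in> space (secret_law \<Q>)" for z \<theta>
      using measurable_space[OF measurable_server_view[OF D], of "(z, \<theta>)"] that
      by (simp add: sample_space_def space_pair_measure)
    have "?r (server_view \<Q> \<D> \<omega>) = rest_view \<Q> \<D> i \<omega>" for \<omega>
      by (auto simp: server_view_def rest_view_def)
    then have "\<rho> z = L.prob {\<theta> \<in> space (secret_law \<Q>).
        server_view \<Q> \<D> (z, \<theta>) \<in> ?r -` B \<inter> space (view_space \<Q> \<D>)}" if "z \<in> space DX" for z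
      unfolding \<rho>_def using sv that by (intro arg_cong[where f="L.prob"]) auto
    then show ?thesis
      using view_law_depends_on_sum[OF sec D that measurable_sets[OF r B]] that by simp
  qed
  text \<open>Swapping the inputs of \<open>i\<close> and \<open>j\<close> preserves the sum, and the input of \<open>i\<close> does not matter.\<close>
  have upd: "\<rho> (y(j := b)) = \<rho> y"
    if y: "y \<in> space DX" and j: "j \<in> ?U - {i}" and b: "b \<in> space (data_space \<Q>)" for y j b
  proof -
    have yj: "y j \<in> space (data_space \<Q>)" using y j by (auto simp: space_PiM)
    have U: "?U = insert i (insert j (?U - {i, j}))" and ij: "i \<noteq> j" using i j by auto
    have "(\<Sum>k\<in>?U. (y(i := b)) k) = (\<Sum>k\<in>?U. (y(i := y j, j := b)) k)"
    proof -
      have "(\<Sum>k\<in>?U - {i, j}. (y(i := b)) k) = (\<Sum>k\<in>?U - {i, j}. (y(i := y j, j := b)) k)"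
        by (intro sum.cong) auto
      moreover have "(\<Sum>k\<in>?U. z k) = z i + (z j + (\<Sum>k\<in>?U - {i, j}. z k))" for z :: "nat \<Rightarrow> 'x"
        using fin ij by (subst U) (simp add: sum.insert)
      ultimately show ?thesis using ij by (simp add: add_ac)
    qed
    moreover have "y(i := b) \<in> space DX" "y(i := y j, j := b) \<in> space DX"
      using y b yj i j by (auto simp: space_PiM PiE_iff extensional_def)
    ultimately have "\<rho> (y(i := b)) = \<rho> (y(i := y j, j := b))"
      by (intro \<rho>_sum)
    moreover have "\<rho> (y(i := b)) = \<rho> y" "\<rho> (y(i := y j, j := b)) = \<rho> (y(j := b))"
      by (rule \<rho>_cong; simp)+
    ultimately show ?thesis by simp
  qed
  \<comment> \<open>The entries of \<open>x\<close> are replaced by those of \<open>x'\<close> one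
    at a time; the final vector differs from \<open>x'\<close> only where \<open>\<rho>\<close> does
    not look.\<close>
  have "\<rho> (\<lambda>k. if k \<in> J then x' k else x k) = \<rho> x" if "finite J" "J \<subseteq> ?U - {i}" for J
    using that
  proof (induction J)
    case (insert j J)
    let ?y = "\<lambda>k. if k \<in> J then x' k else x k"
    have "?y \<in> space DX" using x by (auto simp: space_PiM PiE_iff extensional_def)
    moreover have "x' j \<in> space (data_space \<Q>)" using x insert.prems by (auto simp: space_PiM)
    ultimately have "\<rho> (?y(j := x' j)) = \<rho> ?y" using insert.prems by (intro upd) auto
    moreover have "?y(j := x' j) = (\<lambda>k. if k \<in> insert j J then x' k else x k)" by auto
    ultimately show ?case using insert by simp
  qed simp
  from this[of "?U - {i}"] fin have "\<rho> (\<lambda>k. if k \<in> ?U - {i} then x' k else x k) = \<rho> x" by simp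
  moreover have "\<rho> (\<lambda>k. if k \<in> ?U - {i} then x' k else x k) = \<rho> x'" by (rule \<rho>_cong) simp
  ultimately show ?thesis by (simp add: \<rho>_def)
qed

text \<open>Given the data, the partial view has a law that does not vary with them, so Fubini
  factors the joint probability.\<close>

lemma rest_view_indep_data:
  assumes P: "P \<in> data_laws \<Q>" and sec: "secure_given_sum \<Q>" and D: "\<D> \<subseteq> all_users \<Q>"
    and i: "i \<in> all_users \<Q> - \<D>"
    and H: "H \<in> sets DX" and B: "B \<in> sets (rest_space \<Q> \<D> i)"
  shows "measure (joint \<Q> P) {\<omega> \<in> space (joint \<Q> P). fst \<omega> \<in> H \<and> rest_view \<Q> \<D> i \<omega> \<in> B}
    = measure (joint \<Q> P) {\<omega> \<in> space (joint \<Q> P). fst \<omega> \<in> H}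
    * measure (joint \<Q> P) {\<omega> \<in> space (joint \<Q> P). rest_view \<Q> \<D> i \<omega> \<in> B}"
proof -
  interpret P: prob_space P using P by (simp add: data_laws_def)
  interpret J: prob_space "joint \<Q> P" by (rule prob_space_joint[OF P])
  have sP: "sets P = sets DX" using P by (simp add: data_laws_def)
  note spP = sets_eq_imp_space_eq[OF sP]
  have spJ: "space (joint \<Q> P) = space DX \<times> space (secret_law \<Q>)"
    by (simp add: joint_def space_pair_measure spP)
  \<comment> \<open>A reference vector, available since a probability space is nonempty; its section
    probability \<open>c\<close> serves for all data.\<close>
  obtain x\<^sub>0 where x0: "x\<^sub>0 \<in> space DX" using P.not_empty unfolding spP by blast
  define c where "c = L.prob {\<theta> \<in> space (secret_law \<Q>). rest_view \<Q> \<D> i (x\<^sub>0, \<theta>) \<in> B}"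
  have mr: "rest_view \<Q> \<D> i \<in> joint \<Q> P \<rightarrow>\<^sub>M rest_space \<Q> \<D> i"
    by (rule measurable_joint[OF P measurable_rest_view[OF D]])
  have *: "J.prob {\<omega> \<in> space (joint \<Q> P). fst \<omega> \<in> G \<and> rest_view \<Q> \<D> i \<omega> \<in> B} = P.prob G * c"
    if G: "G \<in> sets P" for G
  proof -
    let ?E = "{\<omega> \<in> space (joint \<Q> P). fst \<omega> \<in> G \<and> rest_view \<Q> \<D> i \<omega> \<in> B}"
    have "fst -` G \<inter> space (joint \<Q> P) \<in> sets (joint \<Q> P)"
      unfolding joint_def by (rule measurable_sets[OF measurable_fst G])
    then have "(fst -` G \<inter> space (joint \<Q> P)) \<inter> (rest_view \<Q> \<D> i -` B \<inter> space (joint \<Q> P)) \<in> sets (joint \<Q> P)"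
      by (rule sets.Int[OF _ measurable_sets[OF mr B]])
    also have "(fst -` G \<inter> space (joint \<Q> P)) \<inter> (rest_view \<Q> \<D> i -` B \<inter> space (joint \<Q> P)) = ?E"
      by auto
    finally have "emeasure (joint \<Q> P) ?E = (\<integral>\<^sup>+x. emeasure (secret_law \<Q>) (Pair x -` ?E) \<partial>P)"
      unfolding joint_def by (intro L.emeasure_pair_measure_alt)
    also have "\<dots> = (\<integral>\<^sup>+x. ennreal c * indicator G x \<partial>P)"
    proof (rule nn_integral_cong)
      fix x assume "x \<in> space P"
      then have x: "x \<in> space DX" by (simp add: spP)
      show "emeasure (secret_law \<Q>) (Pair x -` ?E) = ennreal c * indicator G x"
      proof (cases "x \<in> G")
        case True
        then have "Pair x -` ?E = {\<theta> \<in> space (secret_law \<Q>). rest_view \<Q> \<D> i (x, \<theta>) \<in> B}"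
          using x by (auto simp: spJ)
        then show ?thesis
          using True rest_view_law_const[OF sec D i x x0 B] by (simp add: L.emeasure_eq_measure c_def)
      qed auto
    qed
    also have "\<dots> = ennreal (P.prob G * c)"
      by (simp only: nn_integral_cmult_indicator[OF G] P.emeasure_eq_measure)
        (simp add: ennreal_mult mult.commute c_def)
    finally show ?thesis by (simp add: measure_def c_def)
  qed
  \<comment> \<open>Taking the whole data space for \<open>G\<close> identifies \<open>c\<close> as
    the probability of the view event.\<close>
  have "{\<omega> \<in> space (joint \<Q> P). rest_view \<Q> \<D> i \<omega> \<in> B}
      = {\<omega> \<in> space (joint \<Q> P). fst \<omega> \<in> space P \<and> rest_view \<Q> \<D> i \<omega> \<in> B}"
    by (auto simp: spJ spP)
  then have "J.prob {\<omega> \<in> space (joint \<Q> P). rest_view \<Q> \<D> i \<omega> \<in> B} = c"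
    using *[OF sets.top] P.prob_space by simp
  moreover have "J.prob {\<omega> \<in> space (joint \<Q> P). fst \<omega> \<in> H} = P.prob H"
  proof -
    have "emeasure (joint \<Q> P) (H \<times> space (secret_law \<Q>)) = emeasure P H"
      using H by (simp add: joint_def L.emeasure_pair_measure_Times sP L.emeasure_space_1)
    moreover have "{\<omega> \<in> space (joint \<Q> P). fst \<omega> \<in> H} = H \<times> space (secret_law \<Q>)"
      using sets.sets_into_space[OF H] by (auto simp: spJ)
    ultimately show ?thesis by (simp add: measure_def)
  qed
  ultimately show ?thesis using *[of H] H sP by simp
qed

end

section \<open>The entropy bound\<close>

theorem lemma3p1:
  fixes \<Q> :: "('x::ab_group_add, 't, 'y, 'h) protocol"
    and P :: "(nat \<Rightarrow> 'x) measure"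
    and D i :: nat
    and \<D> :: "nat set"
  assumes "aggregation_protocol \<Q>"
    and "P \<in> data_laws \<Q>"
    and "correct \<Q> D P"
    and "secure_given_sum \<Q>"
    and "secure_beyond \<Q> D"
    and "real D \<le> real (users \<Q>) / 2"
    and "\<D> \<subseteq> all_users \<Q>"
    and "card \<D> \<le> D"
    and "i \<in> all_users \<Q> - \<D>"
  shows "shannon_entropy (joint \<Q> P) (msg_space \<Q> i) (msg \<Q> i)
      \<ge> shannon_entropy (joint \<Q> P) (sum_space \<Q>) (data_sum (all_users \<Q> - \<D>))"
proof -
  let ?J = "joint \<Q> P" and ?U = "all_users \<Q> - \<D>"
  note protocol = assms(1) and P = assms(2) and sec = assms(4) and D = assms(7) and i = assms(9)
  interpret prob_space ?J by (rule prob_space_joint[OF protocol P])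
  interpret information_space ?J 2 by standard simp
  have U: "?U \<subseteq> all_users \<Q>" by auto
  have mY: "msg \<Q> i \<in> ?J \<rightarrow>\<^sub>M msg_space \<Q> i"
    using i by (intro measurable_joint[OF protocol P] measurable_msg[OF protocol]) auto
  have mV: "rest_view \<Q> \<D> i \<in> ?J \<rightarrow>\<^sub>M rest_space \<Q> \<D> i"
    by (intro measurable_joint[OF protocol P] measurable_rest_view[OF protocol D])
  have mS: "data_sum ?U \<in> ?J \<rightarrow>\<^sub>M sum_space \<Q>"
    by (intro measurable_joint[OF protocol P] measurable_data_sum[OF protocol U])
  \<comment> \<open>Reinserting the message of user \<open>i\<close> into the partial view recovers
    the full server view, to which the decoder applies.\<close>
  define view where "view = (\<lambda>p :: 'y \<times> (nat \<Rightarrow> 'y) \<times> 'h. ((fst (snd p))(i := fst p), snd (snd p)))"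
  have view: "view (msg \<Q> i \<omega>, rest_view \<Q> \<D> i \<omega>) = server_view \<Q> \<D> \<omega>" for \<omega>
    using i by (auto simp: view_def rest_view_def server_view_def fun_eq_iff)
  have "(\<lambda>p. (\<lambda>(f, y). f(i := y)) (fst (snd p), fst p))
      \<in> msg_space \<Q> i \<Otimes>\<^sub>M rest_space \<Q> \<D> i \<rightarrow>\<^sub>M PiM (insert i (?U - {i})) (msg_space \<Q>)"
    by (rule measurable_compose[OF _ measurable_add_dim]) measurable
  moreover have "insert i (?U - {i}) = ?U" using i by auto
  ultimately have mview: "view \<in> msg_space \<Q> i \<Otimes>\<^sub>M rest_space \<Q> \<D> i \<rightarrow>\<^sub>M view_space \<Q> \<D>"
    unfolding view_def view_space_def by (intro measurable_Pair) simp_all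
  have mdec: "dec \<Q> \<D> \<in> view_space \<Q> \<D> \<rightarrow>\<^sub>M sum_space \<Q>"
    using protocol D by (simp add: aggregation_protocol_def)
  show ?thesis
    unfolding shannon_entropy_def[of _ "sum_space \<Q>"]
  proof (rule SUP_least)
    fix s :: "'x \<Rightarrow> nat" assume "s \<in> quantizers (sum_space \<Q>)"
    then have s: "simple_function (sum_space \<Q>) s" by (simp add: quantizers_def)
    \<comment> \<open>Each quantized sum is treated separately; its finite range bounds the
      composition of decoder and quantizer, as the approximation requires.\<close>
    define m where "m = Max (s ` space (sum_space \<Q>))"
    have fin: "finite (s ` space (sum_space \<Q>))" using s by (simp add: simple_function_def)
    have "ereal (entropy 2 (count_space ((s \<circ> data_sum ?U) ` space ?J)) (s \<circ> data_sum ?U)) \<le> (SUP q\<in>quantizers (msg_space \<Q> i). ereal (entropy 2 (count_space ((q \<circ> msg \<Q> i) ` space ?J)) (q \<circ> msg \<Q> i)))"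
    proof (rule entropy_le_SUP_entropy_quantized[OF mY mV, where f="\<lambda>p. s (dec \<Q> \<D> (view p))" and m=m])
      show "simple_function ?J (s \<circ> data_sum ?U)"
        using simple_function_comp[OF mS s] by (simp add: comp_def)
      show "(\<lambda>p. s (dec \<Q> \<D> (view p))) \<in> msg_space \<Q> i \<Otimes>\<^sub>M rest_space \<Q> \<D> i \<rightarrow>\<^sub>M count_space UNIV"
        by (intro measurable_compose[OF mview] measurable_compose[OF mdec] measurable_simple_function s)
      show "s (dec \<Q> \<D> (view p)) \<le> m" if "p \<in> space (msg_space \<Q> i \<Otimes>\<^sub>M rest_space \<Q> \<D> i)" for p
        unfolding m_def using fin measurable_space[OF mdec measurable_space[OF mview that]]
        by (intro Max_ge) auto
      have "AE \<omega> in ?J. dec \<Q> \<D> (server_view \<Q> \<D> \<omega>) = data_sum ?U \<omega>"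
        using assms(3) D assms(8) by (simp add: correct_def)
      then show "AE \<omega> in ?J. (s \<circ> data_sum ?U) \<omega> = s (dec \<Q> \<D> (view (msg \<Q> i \<omega>, rest_view \<Q> \<D> i \<omega>)))"
        by eventually_elim (simp add: view)
    next
      fix t B assume B: "B \<in> sets (rest_space \<Q> \<D> i)"
      let ?DX = "PiM (all_users \<Q>) (\<lambda>_. data_space \<Q>)"
      \<comment> \<open>The event that the quantized sum equals \<open>t\<close> is expressed
        through the data alone, so independence of data and partial view applies to it.\<close>
      define H where "H = {x \<in> space ?DX. s (\<Sum>j\<in>?U. x j) = t}"
      have "(\<lambda>x. s (\<Sum>j\<in>?U. x j)) \<in> ?DX \<rightarrow>\<^sub>M count_space UNIV"
        by (intro measurable_compose[OF measurable_sum[OF protocol U]] measurable_simple_function s)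
      from measurable_sets[OF this, of "{t}"] have H: "H \<in> sets ?DX"
        by (simp add: H_def vimage_def Int_def conj_commute)
      have "(s \<circ> data_sum ?U) \<omega> = t \<longleftrightarrow> fst \<omega> \<in> H" if "\<omega> \<in> space ?J" for \<omega>
        using that sets_eq_imp_space_eq[OF sets_joint[OF protocol P]]
        by (auto simp: H_def data_sum_def sample_space_def space_pair_measure)
      then have "{\<omega> \<in> space ?J. (s \<circ> data_sum ?U) \<omega> = t} = {\<omega> \<in> space ?J. fst \<omega> \<in> H}"
        "{\<omega> \<in> space ?J. (s \<circ> data_sum ?U) \<omega> = t \<and> rest_view \<Q> \<D> i \<omega> \<in> B}
          = {\<omega> \<in> space ?J. fst \<omega> \<in> H \<and> rest_view \<Q> \<D> i \<omega> \<in> B}"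
        by blast+
      then show "prob {\<omega> \<in> space ?J. (s \<circ> data_sum ?U) \<omega> = t \<and> rest_view \<Q> \<D> i \<omega> \<in> B}
          = prob {\<omega> \<in> space ?J. (s \<circ> data_sum ?U) \<omega> = t} * prob {\<omega> \<in> space ?J. rest_view \<Q> \<D> i \<omega> \<in> B}"
        using rest_view_indep_data[OF protocol P sec D i H B] by simp
    qed
    then show "ereal (entropy 2 (count_space ((s \<circ> data_sum ?U) ` space ?J)) (s \<circ> data_sum ?U))
        \<le> shannon_entropy ?J (msg_space \<Q> i) (msg \<Q> i)"
      by (simp add: shannon_entropy_def)
  qed
qed

end
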